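(* Let $\mathcal{D}\subset\mathbb{R}^n\times\mathbb{R}^m$ be a domain, let $f\in\mathcal{C}^r(\mathcal{D},\mathbb{R}^n)$, $g\in\mathcal{C}^r(\mathcal{D},\mathbb{R}^m)$ with $r\geq2$, and consider the slow–fast system $$\varepsilon\dot x=f(x,y),\qquad\dot y=g(x,y).$$ Let $\mathcal{N}\subset\mathcal{D}$ be open and let $x^\star:\mathcal{N}_0\to\mathbb{R}^n$ be a $\mathcal{C}^r$ function, defined on an open set $\mathcal{N}_0\subset\mathbb{R}^m$, such that all solutions of $f(x,y)=0$ in $\mathcal{N}$ are given by $x=x^\star(y)$. Let $A(y)=\frac{\partial f}{\partial x}(x^\star(y),y)$, and assume that $\det A(y)$ is bounded away from $0$ whenever $(x^\star(y),y)\in\mathcal{N}$. Assume that the eigenvalues $a_j(y)$ of $A(y)$ satisfy $$\operatorname{Re}a_j(y)\leq-a_0\qquad\forall y\in\mathcal{N}_0,\quad j=1,\dots,n,$$ for some constant $a_0>0$. Let $f$ and $g$, as well as their derivatives up to order $2$, be uniformly bounded in $\mathcal{N}$. Then there exist constants $\varepsilon_0,c_0,c_1,c_2,c_3,c_4,K_0>0$ such that the following properties hold for $0<\varepsilon<\varepsilon_0$. 1. Any solution of the slow–fast system with initial condition $(x_0,y_0)\in\mathcal{N}$ such that $\|x_0-x^\star(y_0)\|<c_0$ satisfies $$\|x(t)-x^\star(y(t))\|\leq c_1\varepsilon+c_2\|x_0-x^\star(y_0)\|e^{-K_0t/\varepsilon}$$ for all $t\geq0$ such that $(x(s),y(s))\in\mathcal{N}$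 for $0\leq s\leq t$. 2. Let $y^0(t)$ be the solution of the reduced system $$\dot y^0=G(y^0):=g(x^\star(y^0),y^0)$$ with initial condition $y^0(0)=y_0$. Let $K_1$ be a Lipschitz constant for $G$ in $\mathcal{N}_0$. Then $$\|y(t)-y^0(t)\|\leq c_3\varepsilon e^{K_1t}+c_4\|x_0-x^\star(y_0)\|e^{-K_0t/\varepsilon}$$ for all $t\geq0$ such that $(x(s),y(s))\in\mathcal{N}$ for $0\leq s\leq t$.
   Context: In part 2, $(x(t),y(t))$ is a solution as in part 1, with initial condition $(x_0,y_0)\in\mathcal{N}$, $\|x_0-x^\star(y_0)\|<c_0$, and $K_1>0$. The setting comes from the implicit function theorem: if $f(x_0,y_0)=0$ and $\det\frac{\partial f}{\partial x}(x_0,y_0)\neq0$, there is a neighbourhood $\mathcal{N}$ of such a point in which the zero set of $f$ (the slow manifold) is the graph $x=x^\star(y)$ of a $\mathcal{C}^r$ function defined on a neighbourhood $\mathcal{N}_0$ of $y_0$ in $\mathbb{R}^m$; one considers points $(x,y)\in\mathcal{N}$ with $y\in\mathcal{N}_0$, and solutions $y^0(t)$ as long as they remain in $\mathcal{N}_0$.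
   Formalization: Added: for some δ>0, any (x,y) in N with y in N_0 and ‖x−x*(y)‖<δ is joined to (x*(y),y) by a segment inside N (false for arbitrary open N); c_3 may depend on K_1 (uniform c_3 fails for constant G); the graph of x* over N_0 is assumed to lie in D. *)

theory Defs
  imports "HOL-Analysis.Analysis"
begin

(* Only used for open S in finite-dimensional spaces, where asking for all directional
   derivatives x |-> Df(x) v to be of class C^k amounts to asking it for Df itself. *)
primrec Ck_on :: "nat \<Rightarrow> 'a::euclidean_space set \<Rightarrow> ('a \<Rightarrow> 'b::euclidean_space) \<Rightarrow> bool" where
  "Ck_on 0 S f \<longleftrightarrow> continuous_on S f"
| "Ck_on (Suc k) S f \<longleftrightarrow>
     (\<forall>x\<in>S. f differentiable (at x)) \<and>
     (\<forall>v. Ck_on k S (\<lambda>x. frechet_derivative f (at x) v))"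

definition second_derivative ::
  "('a::euclidean_space \<Rightarrow> 'b::euclidean_space) \<Rightarrow> 'a \<Rightarrow> 'a \<Rightarrow> 'a \<Rightarrow> 'b" where
  "second_derivative f p u v =
     frechet_derivative (\<lambda>q. frechet_derivative f (at q) u) (at p) v"

definition bounded_C2_on ::
  "'a::euclidean_space set \<Rightarrow> ('a \<Rightarrow> 'b::euclidean_space) \<Rightarrow> bool" where
  "bounded_C2_on S f \<longleftrightarrow>
     (\<exists>B. \<forall>p\<in>S. norm (f p) \<le> B \<and>
        (\<forall>u. norm (frechet_derivative f (at p) u) \<le> B * norm u) \<and>
        (\<forall>u v. norm (second_derivative f p u v) \<le> B * norm u * norm v))"

(* Complex eigenvalues of a real square matrix. *)
definition eigenvalue_of :: "real^'n^'n \<Rightarrow> complex \<Rightarrow> bool" where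
  "eigenvalue_of M a \<longleftrightarrow>
     (\<exists>v :: complex^'n. v \<noteq> 0 \<and> (\<chi> i j. complex_of_real (M $ i $ j)) *v v = a *s v)"

definition fast_jacobian ::
  "((real^'n) \<times> (real^'m) \<Rightarrow> real^'n) \<Rightarrow> (real^'m \<Rightarrow> real^'n) \<Rightarrow> real^'m \<Rightarrow> real^'n^'n" where
  "fast_jacobian f xs y = matrix (frechet_derivative (\<lambda>x. f (x, y)) (at (xs y)))"

definition reduced_field ::
  "((real^'n) \<times> (real^'m) \<Rightarrow> real^'m) \<Rightarrow> (real^'m \<Rightarrow> real^'n) \<Rightarrow> real^'m \<Rightarrow> real^'m" where
  "reduced_field g xs y = g (xs y, y)"

(* Points of N sufficiently close to the graph of xs are joined to the graph, inside N, by a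
   segment in the fibre over y.  This holds if N contains a tube of uniform width around the
   graph, or if the fibres of N are convex and contain the points xs y.  For an arbitrary open N,
   bounds on derivatives on N give no control between the graph and nearby points of N:
   take n = m = 1, xs = 0, g = 0, w y = 1 / (1 + y^2),
   N = {(x, y). |x| < w y} \<union> {(x, y). 2 * w y < |x| < 10}, f (x, y) = - x on the first set
   and f (x, y) = sgn x on the second. *)
definition segments_near_graph ::
  "((real^'n) \<times> (real^'m)) set \<Rightarrow> (real^'m) set \<Rightarrow> (real^'m \<Rightarrow> real^'n) \<Rightarrow> bool" where
  "segments_near_graph N N0 xs \<longleftrightarrow>
     (\<exists>\<delta>>0. \<forall>x y. (x, y) \<in> N \<longrightarrow> y \<in> N0 \<longrightarrow> norm (x - xs y) < \<delta> \<longrightarrow>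
        (\<forall>z\<in>closed_segment (xs y) x. (z, y) \<in> N))"

definition slow_fast_solution ::
  "((real^'n) \<times> (real^'m)) set \<Rightarrow> ((real^'n) \<times> (real^'m) \<Rightarrow> real^'n) \<Rightarrow>
   ((real^'n) \<times> (real^'m) \<Rightarrow> real^'m) \<Rightarrow> real \<Rightarrow> real set \<Rightarrow>
   (real \<Rightarrow> real^'n) \<Rightarrow> (real \<Rightarrow> real^'m) \<Rightarrow> bool" where
  "slow_fast_solution D f g \<epsilon> J x y \<longleftrightarrow>
     is_interval J \<and> 0 \<in> J \<and>
     (\<forall>t\<in>J. (x t, y t) \<in> D \<and>
        (\<exists>x'. (x has_vector_derivative x') (at t within J) \<and> \<epsilon> *\<^sub>R x' = f (x t, y t)) \<and>
        (y has_vector_derivative g (x t, y t)) (at t within J))"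

definition ode_solution ::
  "(real^'m) set \<Rightarrow> (real^'m \<Rightarrow> real^'m) \<Rightarrow> real set \<Rightarrow> (real \<Rightarrow> real^'m) \<Rightarrow> bool" where
  "ode_solution U G J y \<longleftrightarrow>
     is_interval J \<and> 0 \<in> J \<and>
     (\<forall>t\<in>J. y t \<in> U \<and> (y has_vector_derivative G (y t)) (at t within J))"

end

theory Submission
  imports Defs "HOL-Computational_Algebra.Fundamental_Theorem_Algebra"
begin

text \<open>
  The distance \<open>z = x - xs y\<close> to the slow manifold obeys
  \<open>\<epsilon> z' = A(y) z + O(|z|^2) + O(\<epsilon>)\<close>, because \<open>f\<close> vanishes on the graph and \<open>xs\<close> has a bounded
  derivative (differentiate \<open>f (xs y, y) = 0\<close> and use that \<open>A(y)\<close> is boundedly invertible).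
  The matrices \<open>A(y)\<close> are bounded and their spectra lie in \<open>Re \<le> - a0\<close>, so \<open>z\<close> should
  decay at an exponential rate of order \<open>1 / \<epsilon>\<close> until it is of size \<open>O(\<epsilon>)\<close>. Two points need care.

  The first is uniformity in \<open>y\<close>, which ranges over a set that need not be compact. Lemma
  \<open>uniform_lyapunov\<close> gives, for every matrix \<open>A\<close> with \<open>|A| \<le> B\<close> and spectrum in \<open>Re \<le> - a0\<close>, a
  quadratic Lyapunov form whose constants depend only on \<open>B\<close>, \<open>a0\<close> and the dimension. The form is
  explicit. If \<open>(A - l_1) \<dots> (A - l_k) = 0\<close> with eigenvalues \<open>l_j\<close>, then the vectors
  \<open>u_j = (A - l_j) \<dots> (A - l_1) u\<close> satisfy \<open>A u_j = l_(j+1) u_j + u_(j+1)\<close>; along \<open>u' = A u\<close> they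
  form a triangular system, and the sum of the \<open>|u_j|^2\<close> with suitable geometric weights
  decreases.

  The second is the dependence on \<open>y\<close>: the form depends on a choice of eigenvalues, hence has no
  reason to be continuous in \<open>y\<close>. Therefore it is frozen on time windows of length proportional to
  \<open>\<epsilon>\<close>. On such a window \<open>A(y)\<close> moves only by \<open>O(\<epsilon>)\<close>, and the frozen form still decays
  (\<open>decay_on_window\<close>). The window is just long enough for the loss incurred by
  exchanging forms to be compensated, so that \<open>|z|\<close> is halved up to \<open>O(\<epsilon>)\<close>. Iterating over the
  windows gives the first estimate (\<open>slow_manifold_attraction\<close>). All bounds are available only near
  the graph, where segments to the graph stay in \<open>N\<close>; the barrier argument of \<open>barrier_decay\<close> shows
  that solutions do not leave this region.

  For the second estimate, \<open>w = y - y0\<close> satisfies \<open>|w'| \<le> K1 |w| + B |z|\<close>, and the bound on \<open>|z|\<close>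
  integrates to \<open>O(\<epsilon>)\<close>, the initial layer having duration \<open>O(\<epsilon>)\<close>; Gronwall's argument concludes
  (\<open>reduced_dynamics_error\<close>).
\<close>

section \<open>Products of eigenvalue shifts that annihilate a matrix\<close>

text \<open>
  The vector \<open>p(M) v\<close>, in Horner form so that induction on \<open>p\<close> computes it.
\<close>

definition poly_apply :: "complex^'n^'n \<Rightarrow> complex poly \<Rightarrow> complex^'n \<Rightarrow> complex^'n" where
  "poly_apply M p v = fold_coeffs (\<lambda>a w. a *s v + M *v w) p 0"

lemma poly_apply_0 [simp]: "poly_apply M 0 v = 0"
  by (simp add: poly_apply_def)

lemma poly_apply_pCons [simp]: "poly_apply M (pCons a p) v = a *s v + M *v poly_apply M p v"
  by (cases "a = 0 \<and> p = 0") (auto simp: poly_apply_def)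

lemma poly_apply_add: "poly_apply M (p + q) v = poly_apply M p v + poly_apply M q v"
  by (induction p q rule: poly_induct2)
     (simp_all add: matrix_vector_right_distrib vector_sadd_rdistrib)

lemma poly_apply_diff: "poly_apply M (p - q) v = poly_apply M p v - poly_apply M q v"
  using poly_apply_add[of M "p - q" q v] by simp

lemma poly_apply_smult: "poly_apply M (smult c p) v = c *s poly_apply M p v"
  by (induction p) (simp_all add: vector_add_ldistrib vector_scalar_commute)

lemma poly_apply_sum: "poly_apply M (\<Sum>i\<in>I. h i) v = (\<Sum>i\<in>I. poly_apply M (h i) v)"
  by (induction I rule: infinite_finite_induct) (simp_all add: poly_apply_add)

lemma poly_apply_diff_vec: "poly_apply M p (v - w) = poly_apply M p v - poly_apply M p w"
  by (induction p)
     (simp_all add: matrix_vector_mult_diff_distrib vector_ssub_ldistrib)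

lemma poly_apply_scale_vec: "poly_apply M p (c *s v) = c *s poly_apply M p v"
  by (induction p) (simp_all add: vector_add_ldistrib vector_scalar_commute mult.commute)

lemma poly_apply_mult_vec: "poly_apply M p (M *v v) = M *v poly_apply M p v"
  by (induction p) (simp_all add: matrix_vector_right_distrib vector_scalar_commute)

primrec matpow :: "complex^'n^'n \<Rightarrow> nat \<Rightarrow> complex^'n^'n" where
  "matpow M 0 = mat 1"
| "matpow M (Suc k) = M ** matpow M k"

lemma poly_apply_monom: "poly_apply M (monom c k) v = c *s (matpow M k *v v)"
  by (induction k) (simp_all add: monom_0 monom_Suc vector_scalar_commute matrix_vector_mul_assoc)

text \<open>
  Dependence of an indexed family, which may have repetitions: a repetition is itself a dependence,
  and otherwise the range is a set with more elements than the dimension.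
\<close>

lemma linear_dependence_family:
  fixes h :: "nat \<Rightarrow> 'a::euclidean_space"
  assumes "DIM('a) \<le> N"
  shows "\<exists>c :: nat \<Rightarrow> real. (\<exists>i\<le>N. c i \<noteq> 0) \<and> (\<Sum>i\<le>N. c i *\<^sub>R h i) = 0"
proof (cases "inj_on h {..N}")
  case True
  then have "card (h ` {..N}) = Suc N" by (simp add: card_image)
  then have "dependent (h ` {..N})" using assms by (intro dependent_biggerset) auto
  then obtain u where u: "\<exists>v\<in>h ` {..N}. u v \<noteq> 0" "(\<Sum>v\<in>h ` {..N}. u v *\<^sub>R v) = 0"
    using dependent_finite[of "h ` {..N}"] by auto
  then show ?thesis using True
    by (intro exI[of _ "\<lambda>i. u (h i)"]) (auto simp: sum.reindex)
next
  case False
  then obtain i j where ij: "i \<le> N" "j \<le> N" "i \<noteq> j" "h i = h j" by (auto simp: inj_on_def)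
  have "(\<Sum>k\<le>N. ((if k = i then 1 else 0) - (if k = j then 1 else 0)) *\<^sub>R h k) = h i - h j"
    using ij by (simp add: scaleR_diff_left sum_subtractf if_distrib[of "\<lambda>c. c *\<^sub>R _"] cong: if_cong)
  then show ?thesis using ij
    by (intro exI[of _ "\<lambda>k. (if k = i then 1 else 0) - (if k = j then 1 else 0)"]) auto
qed

lemma scaleR_matrix_vector: "(c *\<^sub>R (M :: complex^'n^'n)) *v v = complex_of_real c *s (M *v v)"
  by (simp add: vec_eq_iff matrix_vector_mult_def sum_distrib_left mult.assoc
      scaleR_conv_of_real[where 'a = complex])

lemma sum_matrix_vector: "(\<Sum>i\<in>I. h i) *v v = (\<Sum>i\<in>I. (h i :: complex^'n^'n) *v v)"
  by (induction I rule: infinite_finite_induct) (simp_all add: matrix_vector_mult_add_rdistrib)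

text \<open>
  The powers of \<open>M\<close> lie in a space of finite dimension. The Cayley-Hamilton degree is not reached, but
  any bound that depends on the dimension alone serves the purpose.
\<close>

lemma annihilating_polynomial:
  fixes M :: "complex^'n^'n"
  shows "\<exists>p. p \<noteq> 0 \<and> degree p \<le> DIM(complex^'n^'n) \<and> (\<forall>v. poly_apply M p v = 0)"
proof -
  let ?N = "DIM(complex^'n^'n)"
  obtain c :: "nat \<Rightarrow> real" and k where k: "k \<le> ?N" "c k \<noteq> 0"
    and c: "(\<Sum>i\<le>?N. c i *\<^sub>R matpow M i) = 0"
    using linear_dependence_family[of ?N "matpow M"] by auto
  define p where "p = (\<Sum>i\<le>?N. monom (complex_of_real (c i)) i)"
  have "coeff p k = complex_of_real (c k)"
    using k by (simp add: p_def coeff_sum if_distrib[of complex_of_real] cong: if_cong)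
  then have "p \<noteq> 0" using k by auto
  moreover have "degree p \<le> ?N"
    unfolding p_def by (intro degree_sum_le) (auto intro: order_trans[OF degree_monom_le])
  moreover have "poly_apply M p v = 0" for v
  proof -
    have "poly_apply M p v = (\<Sum>i\<le>?N. c i *\<^sub>R matpow M i) *v v"
      by (simp add: p_def poly_apply_sum poly_apply_monom sum_matrix_vector scaleR_matrix_vector)
    then show ?thesis unfolding c by simp
  qed
  ultimately show ?thesis by blast
qed

definition shift :: "complex^'n^'n \<Rightarrow> complex \<Rightarrow> complex^'n \<Rightarrow> complex^'n" where
  "shift M l v = M *v v - l *s v"

text \<open>
  Split off a root \<open>r\<close> of \<open>p\<close>, say \<open>p = (x - r) q\<close>. If \<open>r\<close> is an eigenvalue, read \<open>p(M) v = 0\<close> as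
  \<open>q(M) ((M - r) v) = 0\<close> and put \<open>r\<close> on the list. If it is not, \<open>M - r\<close> is injective and
  \<open>(M - r) (q(M) v) = 0\<close> already gives \<open>q(M) v = 0\<close>. Quantifying over single vectors \<open>v\<close> is what
  makes both cases fit the same induction.
\<close>

lemma eigenvalue_shifts_kill_kernel:
  fixes M :: "complex^'n^'n"
  assumes "p \<noteq> 0"
  shows "\<exists>ls. length ls \<le> degree p \<and>
           (\<forall>l\<in>set ls. \<exists>w. w \<noteq> 0 \<and> M *v w = l *s w) \<and>
           (\<forall>v. poly_apply M p v = 0 \<longrightarrow> fold (shift M) ls v = 0)"
  using assms
proof (induction "degree p" arbitrary: p)
  case 0
  then obtain a where "p = [:a:]" "a \<noteq> 0" by (metis degree_eq_zeroE pCons_0_0)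
  then show ?case by (intro exI[of _ "[]"]) simp
next
  case (Suc n)
  then have "\<not> constant (poly p)" by (simp add: constant_degree)
  then obtain r where "poly p r = 0" using fundamental_theorem_of_algebra by blast
  then obtain q where q: "p = [:-r, 1:] * q" by (auto simp: poly_eq_0_iff_dvd)
  with Suc have q0: "q \<noteq> 0" by auto
  have "degree p = Suc (degree q)" using q q0 by (subst q, subst degree_mult_eq) auto
  with Suc have dq: "n = degree q" by simp
  obtain ls where ls: "length ls \<le> degree q"
      "\<forall>l\<in>set ls. \<exists>w. w \<noteq> 0 \<and> M *v w = l *s w"
      "\<And>v. poly_apply M q v = 0 \<Longrightarrow> fold (shift M) ls v = 0"
    using Suc.hyps(1)[OF dq q0] by blast
  have p1: "poly_apply M p v = shift M r (poly_apply M q v)" for v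
    by (simp add: q shift_def poly_apply_diff poly_apply_smult)
  have p2: "poly_apply M p v = poly_apply M q (shift M r v)" for v
    unfolding p1
    by (simp add: shift_def poly_apply_diff_vec poly_apply_scale_vec poly_apply_mult_vec)
  show ?case
  proof (cases "\<exists>w. w \<noteq> 0 \<and> M *v w = r *s w")
    case True
    then show ?thesis using ls dq Suc(2) p2 by (intro exI[of _ "r # ls"]) auto
  next
    case False
    then have "poly_apply M p v = 0 \<Longrightarrow> poly_apply M q v = 0" for v
      unfolding p1 shift_def by auto
    then show ?thesis using ls dq Suc(2) by (intro exI[of _ ls]) auto
  qed
qed

lemma eigenvalue_shifts_annihilate:
  fixes M :: "complex^'n^'n"
  shows "\<exists>ls. length ls \<le> DIM(complex^'n^'n) \<and>
           (\<forall>l\<in>set ls. \<exists>w. w \<noteq> 0 \<and> M *v w = l *s w) \<and> (\<forall>v. fold (shift M) ls v = 0)"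
proof -
  obtain p where p: "p \<noteq> 0" "degree p \<le> DIM(complex^'n^'n)" "\<forall>v. poly_apply M p v = 0"
    using annihilating_polynomial by blast
  with eigenvalue_shifts_kill_kernel[OF p(1), of M] show ?thesis by (meson order_trans)
qed

section \<open>A Lyapunov form with uniform constants\<close>

lemma inner_scalar_self: "v \<bullet> (l *s v) = Re l * (norm v)\<^sup>2" for v :: "complex^'n"
proof -
  have "z \<bullet> (l * z) = Re l * (z \<bullet> z)" for z :: complex
    by (simp add: inner_complex_def algebra_simps)
  then show ?thesis
    by (simp add: power2_norm_eq_inner inner_vec_def sum_distrib_left)
qed

lemma norm_scalar_vector: "norm (l *s v) = cmod l * norm v" for v :: "complex^'n"
  by (simp add: norm_vec_def norm_mult L2_set_left_distrib L2_set_right_distrib)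

text \<open>
  Unrolled, this is the sum of \<open>q^j * (u_j \<bullet> v_j)\<close>, where \<open>u_j\<close> and \<open>v_j\<close> arise from \<open>u\<close> and \<open>v\<close> by the
  first \<open>j\<close> shifts of the list.
\<close>

primrec lyapunov_form :: "complex^'n^'n \<Rightarrow> real \<Rightarrow> complex list \<Rightarrow> complex^'n \<Rightarrow> complex^'n \<Rightarrow> real" where
  "lyapunov_form M q [] u v = 0"
| "lyapunov_form M q (l # ls) u v = u \<bullet> v + q * lyapunov_form M q ls (shift M l u) (shift M l v)"

lemma shift_add: "shift M l (u + v) = shift M l u + shift M l v"
  by (simp add: shift_def matrix_vector_right_distrib vector_add_ldistrib)

lemma scaleR_vec_eq: "c *\<^sub>R v = complex_of_real c *s v" for v :: "complex^'n"
  by (simp add: vec_eq_iff scaleR_conv_of_real[where 'a = complex])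

lemma shift_scaleR: "shift M l (c *\<^sub>R u) = c *\<^sub>R shift M l u"
  unfolding scaleR_vec_eq
  by (simp add: shift_def vector_scalar_commute vector_ssub_ldistrib vector_smult_assoc mult.commute)

lemma shift_mult: "shift M l (M *v v) = M *v shift M l v"
  by (simp add: shift_def matrix_vector_mult_diff_distrib vector_scalar_commute)

lemma lyapunov_form_sym: "lyapunov_form M q ls u v = lyapunov_form M q ls v u"
proof (induction ls arbitrary: u v)
  case (Cons l ls)
  show ?case by (simp add: inner_commute[of u v] Cons[of "shift M l u"])
qed simp

lemma lyapunov_form_add: "lyapunov_form M q ls (u + w) v = lyapunov_form M q ls u v + lyapunov_form M q ls w v"
  by (induction ls arbitrary: u v w) (simp_all add: inner_add_left shift_add algebra_simps)

lemma lyapunov_form_scaleR: "lyapunov_form M q ls (c *\<^sub>R u) v = c * lyapunov_form M q ls u v"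
  by (induction ls arbitrary: u v) (simp_all add: shift_scaleR algebra_simps)

lemma lyapunov_form_nonneg: "q \<ge> 0 \<Longrightarrow> lyapunov_form M q ls v v \<ge> 0"
  by (induction ls arbitrary: v) auto

text \<open>
  Annihilation excludes the empty list unless \<open>v = 0\<close>; otherwise the leading term is \<open>|v|^2\<close>.
\<close>

lemma lyapunov_form_lower:
  assumes "q \<ge> 0" "fold (shift M) ls v = 0"
  shows "(norm v)\<^sup>2 \<le> lyapunov_form M q ls v v"
  using assms by (cases ls) (auto simp: power2_norm_eq_inner lyapunov_form_nonneg)

lemma norm_shift_le:
  assumes "\<And>v. norm (M *v v) \<le> B * norm v" "\<exists>w. w \<noteq> 0 \<and> M *v w = l *s w"
  shows "norm (shift M l v) \<le> 2 * B * norm v"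
proof -
  obtain w where w: "w \<noteq> 0" "M *v w = l *s w" using assms by auto
  have "cmod l * norm w \<le> B * norm w" using assms(1)[of w] w by (simp add: norm_scalar_vector)
  then have "cmod l \<le> B" using w by simp
  then have "norm (l *s v) \<le> B * norm v" by (simp add: norm_scalar_vector mult_right_mono)
  then show ?thesis unfolding shift_def
    using norm_triangle_ineq4[of "M *v v" "l *s v"] assms(1)[of v] by simp
qed

lemma lyapunov_form_upper:
  assumes M: "\<And>v. norm (M *v v) \<le> B * norm v" and q: "q \<ge> 0"
    and "\<forall>l\<in>set ls. \<exists>w. w \<noteq> 0 \<and> M *v w = l *s w"
  shows "\<bar>lyapunov_form M q ls u v\<bar> \<le> (1 + q * (2 * B)\<^sup>2) ^ length ls * (norm u * norm v)"
  using assms(3)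
proof (induction ls arbitrary: u v)
  case (Cons l ls)
  let ?c = "q * (2 * B)\<^sup>2" and ?U = "shift M l u" and ?V = "shift M l v"
  have sh: "norm (shift M l w) \<le> 2 * B * norm w" for w
    using norm_shift_le[OF M] Cons.prems by auto
  have c0: "?c \<ge> 0" using q by simp
  have "norm ?U * norm ?V \<le> (2 * B * norm u) * (2 * B * norm v)"
    by (intro mult_mono' sh) auto
  also have "\<dots> = (2 * B)\<^sup>2 * (norm u * norm v)" by (simp add: power2_eq_square)
  finally have *: "norm ?U * norm ?V \<le> (2 * B)\<^sup>2 * (norm u * norm v)" .
  have "\<bar>lyapunov_form M q ls ?U ?V\<bar> \<le> (1 + ?c) ^ length ls * (norm ?U * norm ?V)"
    using Cons by auto
  also have "\<dots> \<le> (1 + ?c) ^ length ls * ((2 * B)\<^sup>2 * (norm u * norm v))"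
    using * c0 by (intro mult_left_mono) auto
  finally have "q * \<bar>lyapunov_form M q ls ?U ?V\<bar> \<le> q * ((1 + ?c) ^ length ls * ((2 * B)\<^sup>2 * (norm u * norm v)))"
    using q by (rule mult_left_mono)
  then have 1: "\<bar>q * lyapunov_form M q ls ?U ?V\<bar> \<le> ?c * (1 + ?c) ^ length ls * (norm u * norm v)"
    using q by (simp add: abs_mult algebra_simps)
  have "\<bar>u \<bullet> v\<bar> \<le> norm u * norm v" by (rule Cauchy_Schwarz_ineq2)
  also have "\<dots> \<le> (1 + ?c) ^ length ls * (norm u * norm v)"
    using mult_right_mono[OF one_le_power[of "1 + ?c" "length ls"], of "norm u * norm v"] c0 by simp
  finally have 2: "\<bar>u \<bullet> v\<bar> \<le> (1 + ?c) ^ length ls * (norm u * norm v)" .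
  have "\<bar>lyapunov_form M q (l # ls) u v\<bar> \<le> \<bar>u \<bullet> v\<bar> + \<bar>q * lyapunov_form M q ls ?U ?V\<bar>"
    by simp
  also have "\<dots> \<le> (1 + ?c) ^ length (l # ls) * (norm u * norm v)"
    using 1 2 by (simp add: algebra_simps)
  finally show ?case .
qed simp

text \<open>
  With \<open>S = M - l\<close> one has \<open>v \<bullet> M v = Re l * |v|^2 + v \<bullet> S v\<close>. The coupling term \<open>|v| |S v|\<close> is
  absorbed by \<open>a0 / 4 * |v|^2\<close> and by the surplus \<open>a0 / 4 * |S v|^2\<close> of the induction hypothesis,
  which carries the weight \<open>4 / a0^2\<close>: this weight is the smallest one for which Young's inequality
  closes. The induction needs the surplus term in the conclusion, and it needs the list to
  annihilate \<open>v\<close>, as an empty list leaves no decay.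
\<close>

lemma lyapunov_form_decay:
  assumes "a0 > 0" "\<forall>l\<in>set ls. Re l \<le> - a0" "fold (shift M) ls v = 0"
  shows "lyapunov_form M (4 / a0\<^sup>2) ls v (M *v v)
           \<le> - (a0 / 2) * lyapunov_form M (4 / a0\<^sup>2) ls v v - a0 / 4 * (norm v)\<^sup>2"
  using assms(2,3)
proof (induction ls arbitrary: v)
  case (Cons l ls)
  let ?q = "4 / a0\<^sup>2" and ?S = "shift M l v"
  let ?Q = "lyapunov_form M (4 / a0\<^sup>2) ls"
  have IH: "?Q ?S (M *v ?S) \<le> - (a0 / 2) * ?Q ?S ?S - a0 / 4 * (norm ?S)\<^sup>2"
    using Cons by simp
  have IH': "?q * ?Q ?S (M *v ?S) \<le> - (a0 / 2) * (?q * ?Q ?S ?S) - (norm ?S)\<^sup>2 / a0"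
    using mult_left_mono[OF IH, of ?q] \<open>a0 > 0\<close> by (simp add: field_simps power2_eq_square)
  have "M *v v = l *s v + ?S" by (simp add: shift_def)
  then have "v \<bullet> (M *v v) = Re l * (norm v)\<^sup>2 + v \<bullet> ?S"
    by (simp add: inner_add_right inner_scalar_self)
  also have "\<dots> \<le> - a0 * (norm v)\<^sup>2 + norm v * norm ?S"
    using Cons.prems norm_cauchy_schwarz[of v ?S] by (intro add_mono mult_right_mono) auto
  also have "norm v * norm ?S \<le> a0 / 4 * (norm v)\<^sup>2 + (norm ?S)\<^sup>2 / a0"
    using zero_le_power2[of "a0 / 2 * norm v - norm ?S"] \<open>a0 > 0\<close>
    by (simp add: power2_eq_square field_simps)
  finally have "v \<bullet> (M *v v) \<le> - (3 * a0 / 4) * (norm v)\<^sup>2 + (norm ?S)\<^sup>2 / a0"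
    by (simp add: field_simps)
  with IH' show ?case
    by (simp add: shift_mult power2_norm_eq_inner algebra_simps)
qed simp

definition cvec :: "real^'n \<Rightarrow> complex^'n" where
  "cvec u = (\<chi> i. complex_of_real (u $ i))"

lemma cvec_mult: "(\<chi> i j. complex_of_real (A $ i $ j)) *v cvec u = cvec (A *v u)"
  by (simp add: vec_eq_iff cvec_def matrix_vector_mult_def)

lemma norm_cvec [simp]: "norm (cvec u) = norm u"
  by (simp add: norm_vec_def cvec_def)

lemma cvec_add: "cvec (u + v) = cvec u + cvec v"
  by (simp add: vec_eq_iff cvec_def)

lemma cvec_scaleR: "cvec (c *\<^sub>R u) = c *\<^sub>R cvec u"
  by (simp add: vec_eq_iff cvec_def scaleR_conv_of_real[where 'a = complex])

text \<open>
  A real matrix acts separately on real and imaginary parts, so complexification keeps its bound.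
\<close>

lemma complexified_matrix_bound:
  fixes A :: "real^'n^'n"
  assumes "\<And>u. norm (A *v u) \<le> B * norm u" "B \<ge> 0"
  shows "norm ((\<chi> i j. complex_of_real (A $ i $ j)) *v w) \<le> B * norm w"
proof -
  let ?re = "\<lambda>w :: complex^'n. (\<chi> i. Re (w $ i))" and ?im = "\<lambda>w :: complex^'n. (\<chi> i. Im (w $ i))"
  let ?w = "(\<chi> i j. complex_of_real (A $ i $ j)) *v w"
  have split: "(norm w)\<^sup>2 = (norm (?re w))\<^sup>2 + (norm (?im w))\<^sup>2" for w :: "complex^'n"
    unfolding power2_norm_eq_inner inner_vec_def by (simp add: inner_complex_def sum.distrib)
  have sq: "(norm (A *v u))\<^sup>2 \<le> B\<^sup>2 * (norm u)\<^sup>2" for u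
    using power_mono[OF assms(1)[of u], of 2] by (simp add: power_mult_distrib)
  have "?re ?w = A *v ?re w" "?im ?w = A *v ?im w"
    by (simp_all add: vec_eq_iff matrix_vector_mult_def)
  then have "(norm ?w)\<^sup>2 = (norm (A *v ?re w))\<^sup>2 + (norm (A *v ?im w))\<^sup>2"
    by (subst split) simp
  also have "\<dots> \<le> B\<^sup>2 * (norm (?re w))\<^sup>2 + B\<^sup>2 * (norm (?im w))\<^sup>2"
    by (intro add_mono sq)
  also have "\<dots> = (B * norm w)\<^sup>2"
    by (simp only: power_mult_distrib split[of w] distrib_left)
  finally show ?thesis by (rule power2_le_imp_le) (simp add: assms)
qed

text \<open>
  Along \<open>u' = A u\<close> the last condition means that \<open>Q u u\<close> decays at rate \<open>a\<close>.
\<close>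

definition lyapunov_for :: "real \<Rightarrow> real \<Rightarrow> (real^'n \<Rightarrow> real^'n) \<Rightarrow> (real^'n \<Rightarrow> real^'n \<Rightarrow> real) \<Rightarrow> bool" where
  "lyapunov_for a C A Q \<longleftrightarrow> bounded_bilinear Q \<and> (\<forall>u v. Q u v = Q v u) \<and>
     (\<forall>v. (norm v)\<^sup>2 \<le> Q v v) \<and> (\<forall>u v. \<bar>Q u v\<bar> \<le> C * (norm u * norm v)) \<and>
     (\<forall>v. Q v (A v) \<le> - (a / 2) * Q v v)"

text \<open>
  The constant comes from \<open>lyapunov_form_upper\<close> and the bound on the number of shifts, which is why
  that number has to be controlled by the dimension.
\<close>

lemma uniform_lyapunov:
  fixes a0 B :: real
  assumes "a0 > 0" "B \<ge> 0"
  shows "\<exists>C\<ge>1. \<forall>A :: real^'n^'n. (\<forall>u. norm (A *v u) \<le> B * norm u) \<longrightarrow>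
           (\<forall>a. eigenvalue_of A a \<longrightarrow> Re a \<le> - a0) \<longrightarrow> (\<exists>Q. lyapunov_for a0 C ((*v) A) Q)"
proof -
  let ?q = "4 / a0\<^sup>2"
  define C where "C = (1 + ?q * (2 * B)\<^sup>2) ^ DIM(complex^'n^'n)"
  have C1: "1 \<le> 1 + ?q * (2 * B)\<^sup>2" by simp
  have "C \<ge> 1" unfolding C_def by (rule one_le_power[OF C1])
  moreover have "\<exists>Q. lyapunov_for a0 C ((*v) A) Q"
    if A: "\<forall>u. norm (A *v u) \<le> B * norm u" and ev: "\<forall>a. eigenvalue_of A a \<longrightarrow> Re a \<le> - a0"
    for A :: "real^'n^'n"
  proof -
    define M where "M = (\<chi> i j. complex_of_real (A $ i $ j))"
    have M: "norm (M *v v) \<le> B * norm v" for v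
      using complexified_matrix_bound[of A B v] A assms by (simp add: M_def)
    obtain ls where ls: "length ls \<le> DIM(complex^'n^'n)"
        "\<forall>l\<in>set ls. \<exists>w. w \<noteq> 0 \<and> M *v w = l *s w" "\<And>v. fold (shift M) ls v = 0"
      using eigenvalue_shifts_annihilate[of M] by auto
    have re: "\<forall>l\<in>set ls. Re l \<le> - a0"
      using ls(2) ev by (auto simp: eigenvalue_of_def M_def)
    define Q where "Q u v = lyapunov_form M ?q ls (cvec u) (cvec v)" for u v
    have up: "\<bar>Q u v\<bar> \<le> C * (norm u * norm v)" for u v
    proof -
      have "\<bar>Q u v\<bar> \<le> (1 + ?q * (2 * B)\<^sup>2) ^ length ls * (norm u * norm v)"
        unfolding Q_def using lyapunov_form_upper[OF M _ ls(2), of ?q "cvec u" "cvec v"] by simp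
      also have "\<dots> \<le> C * (norm u * norm v)"
        unfolding C_def by (intro mult_right_mono power_increasing ls(1) C1) auto
      finally show ?thesis .
    qed
    have sym: "Q u v = Q v u" for u v unfolding Q_def by (rule lyapunov_form_sym)
    have add: "Q (u + w) v = Q u v + Q w v" for u v w
      by (simp add: Q_def cvec_add lyapunov_form_add)
    have scale: "Q (c *\<^sub>R u) v = c * Q u v" for c u v
      by (simp add: Q_def cvec_scaleR lyapunov_form_scaleR)
    have "bounded_bilinear Q"
    proof
      show "Q (a + a') b = Q a b + Q a' b" for a a' b by (rule add)
      show "Q a (b + b') = Q a b + Q a b'" for a b b' using add sym by metis
      show "Q (r *\<^sub>R a) b = r *\<^sub>R Q a b" for a b r by (simp add: scale)
      show "Q a (r *\<^sub>R b) = r *\<^sub>R Q a b" for a b r by (simp add: scale sym[of a])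
      show "\<exists>K. \<forall>a b. norm (Q a b) \<le> norm a * norm b * K"
        using up by (intro exI[of _ C]) (simp add: mult.commute)
    qed
    moreover have "(norm v)\<^sup>2 \<le> Q v v" for v
      using lyapunov_form_lower[of ?q M ls "cvec v"] ls(3) by (simp add: Q_def)
    moreover have "Q v (A *v v) \<le> - (a0 / 2) * Q v v" for v
    proof -
      have "Q v (A *v v) = lyapunov_form M ?q ls (cvec v) (M *v cvec v)"
        by (simp add: Q_def M_def cvec_mult)
      also have "\<dots> \<le> - (a0 / 2) * Q v v - a0 / 4 * (norm v)\<^sup>2"
        using lyapunov_form_decay[OF assms(1) re ls(3), of "cvec v"] by (simp add: Q_def)
      also have "\<dots> \<le> - (a0 / 2) * Q v v" using assms by simp
      finally show ?thesis .
    qed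
    ultimately show ?thesis using sym up unfolding lyapunov_for_def by blast
  qed
  ultimately show ?thesis by blast
qed

section \<open>Differential inequalities and derivatives along paths\<close>

text \<open>
  The differential inequality is assumed only as long as \<open>\<phi>\<close> has stayed below \<open>R\<close>. At a first time
  where \<open>\<phi>\<close> reaches \<open>R\<close>, integrating the inequality up to that time bounds \<open>\<phi>\<close> by
  \<open>\<phi> a + \<beta> / \<alpha> < R\<close>, so there is no such time.
\<close>

lemma barrier_decay:
  fixes \<phi> \<phi>' :: "real \<Rightarrow> real"
  assumes cont: "continuous_on {a..b} \<phi>"
    and deriv: "\<And>t. t \<in> {a<..<b} \<Longrightarrow> (\<phi> has_real_derivative \<phi>' t) (at t)"
    and ineq: "\<And>t. t \<in> {a<..<b} \<Longrightarrow> (\<And>s. s \<in> {a..t} \<Longrightarrow> \<phi> s < R) \<Longrightarrow> \<phi>' t \<le> - \<alpha> * \<phi> t + \<beta>"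
    and "\<alpha> > 0" "\<beta> \<ge> 0" "\<phi> a \<ge> 0" "\<phi> a + \<beta> / \<alpha> < R" and t: "t \<in> {a..b}"
  shows "\<phi> t \<le> \<phi> a * exp (- \<alpha> * (t - a)) + \<beta> / \<alpha>"
proof -
  have below: "\<phi> t \<le> \<phi> a * exp (- \<alpha> * (t - a)) + \<beta> / \<alpha>"
    if t: "t \<in> {a..b}" and R: "\<And>s. s \<in> {a..<t} \<Longrightarrow> \<phi> s < R" for t
  proof -
    let ?\<chi> = "\<lambda>s. (\<phi> s - \<beta> / \<alpha>) * exp (\<alpha> * (s - a))"
    have "?\<chi> t \<le> ?\<chi> a"
    proof (rule DERIV_nonpos_imp_decreasing_open[of a t ?\<chi>])
      fix s assume s: "a < s" "s < t"
      have "(?\<chi> has_real_derivative (\<phi>' s + \<alpha> * \<phi> s - \<beta>) * exp (\<alpha> * (s - a))) (at s)"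
        using s t \<open>\<alpha> > 0\<close> by (auto intro!: derivative_eq_intros deriv simp: algebra_simps)
      moreover have "\<phi>' s \<le> - \<alpha> * \<phi> s + \<beta>" using s t R by (intro ineq) auto
      then have "(\<phi>' s + \<alpha> * \<phi> s - \<beta>) * exp (\<alpha> * (s - a)) \<le> 0"
        by (intro mult_nonpos_nonneg) auto
      ultimately show "\<exists>y. (?\<chi> has_real_derivative y) (at s) \<and> y \<le> 0" by blast
    next
      show "continuous_on {a..t} ?\<chi>"
        using t by (intro continuous_intros continuous_on_subset[OF cont]) auto
    qed (use t in auto)
    then have "(\<phi> t - \<beta> / \<alpha>) * exp (\<alpha> * (t - a)) * exp (- \<alpha> * (t - a))
                 \<le> (\<phi> a - \<beta> / \<alpha>) * exp (- \<alpha> * (t - a))"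
      by (intro mult_right_mono) auto
    then have "(\<phi> t - \<beta> / \<alpha>) \<le> (\<phi> a - \<beta> / \<alpha>) * exp (- \<alpha> * (t - a))"
      by (simp add: mult.assoc flip: exp_add)
    also have "\<dots> \<le> \<phi> a * exp (- \<alpha> * (t - a))"
      using assms by (intro mult_right_mono) auto
    finally show ?thesis by simp
  qed
  have "\<phi> s < R" if s: "s \<in> {a..b}" for s
  proof (rule ccontr)
    assume "\<not> \<phi> s < R"
    then have ne: "{a..b} \<inter> \<phi> -` {R..} \<noteq> {}" using s by auto
    have "compact ({a..b} \<inter> \<phi> -` {R..})"
      using continuous_closed_preimage[OF cont closed_atLeastAtMost closed_atLeast]
      by (simp add: compact_eq_bounded_closed bounded_Int)
    then obtain u where u: "u \<in> {a..b}" "R \<le> \<phi> u"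
        and first: "\<And>s. s \<in> {a..b} \<Longrightarrow> R \<le> \<phi> s \<Longrightarrow> u \<le> s"
      using compact_attains_inf[OF _ ne] by auto
    have "\<phi> u \<le> \<phi> a * exp (- \<alpha> * (u - a)) + \<beta> / \<alpha>"
    proof (rule below[OF u(1)])
      fix s assume "s \<in> {a..<u}"
      then show "\<phi> s < R" using first[of s] u(1) by force
    qed
    also have "\<dots> \<le> \<phi> a * 1 + \<beta> / \<alpha>"
      using u assms by (intro add_mono mult_left_mono) auto
    finally show False using u assms by simp
  qed
  then show ?thesis using t by (intro below) auto
qed

lemma vector_mean_value:
  fixes h :: "real \<Rightarrow> 'a::real_normed_vector"
  assumes "\<And>t. t \<in> {a..b} \<Longrightarrow> (h has_vector_derivative h' t) (at t within {a..b})"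
    and "\<And>t. t \<in> {a..b} \<Longrightarrow> norm (h' t) \<le> K" and "a \<le> b"
  shows "norm (h b - h a) \<le> K * (b - a)"
proof -
  have K: "K \<ge> 0" using order_trans[OF norm_ge_zero assms(2), of a] assms(3) by simp
  have "norm (h b - h a) \<le> K * norm (b - a)"
  proof (rule differentiable_bound[of "{a..b}" h "\<lambda>t s. s *\<^sub>R h' t"])
    fix t assume t: "t \<in> {a..b}"
    show "(h has_derivative (\<lambda>s. s *\<^sub>R h' t)) (at t within {a..b})"
      using assms(1)[OF t] by (simp add: has_vector_derivative_def)
    show "onorm (\<lambda>s. s *\<^sub>R h' t) \<le> K"
      using assms(2)[OF t] by (intro onorm_le) (simp add: mult.commute[of K] mult_left_mono)
  qed (use assms in auto)
  then show ?thesis using assms by simp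
qed

lemma differentiable_along_path:
  assumes "F differentiable (at (p t))" "(p has_vector_derivative p') (at t within S)"
  shows "((\<lambda>t. F (p t)) has_vector_derivative frechet_derivative F (at (p t)) p') (at t within S)"
proof -
  have "(F has_derivative frechet_derivative F (at (p t))) (at (p t) within p ` S)"
    using assms(1) by (simp add: frechet_derivative_works[symmetric] has_derivative_at_withinI)
  from vector_derivative_diff_chain_within[OF assms(2) this] show ?thesis by (simp add: o_def)
qed

lemma has_vector_derivative_Pair:
  assumes "(p has_vector_derivative p') (at t within S)" "(q has_vector_derivative q') (at t within S)"
  shows "((\<lambda>t. (p t, q t)) has_vector_derivative (p', q')) (at t within S)"
  using has_derivative_Pair[OF assms[unfolded has_vector_derivative_def]]
  by (simp add: has_vector_derivative_def)

section \<open>Estimates near the slow manifold\<close>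

text \<open>
  The spectral hypothesis enters only through the Lyapunov forms, one for each point of the graph,
  with common constants \<open>C\<close> and \<open>a0\<close>. A single \<open>B\<close> serves for all derivative bounds.
\<close>

locale attracting_slow_manifold =
  fixes N :: "((real^'n) \<times> (real^'m)) set" and N0 :: "(real^'m) set"
    and f :: "(real^'n) \<times> (real^'m) \<Rightarrow> real^'n" and g :: "(real^'n) \<times> (real^'m) \<Rightarrow> real^'m"
    and xs :: "real^'m \<Rightarrow> real^'n" and B C \<delta> a0 :: real
  assumes open_N: "open N" and open_N0: "open N0"
    and f_diff: "\<And>p. p \<in> N \<Longrightarrow> f differentiable (at p)"
    and Df_diff: "\<And>p u. p \<in> N \<Longrightarrow> (\<lambda>q. frechet_derivative f (at q) u) differentiable (at p)"
    and g_diff: "\<And>p. p \<in> N \<Longrightarrow> g differentiable (at p)"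
    and xs_diff: "\<And>y. y \<in> N0 \<Longrightarrow> xs differentiable (at y)"
    and zero: "\<And>y. y \<in> N0 \<Longrightarrow> (xs y, y) \<in> N \<Longrightarrow> f (xs y, y) = 0"
    and \<delta>_pos: "\<delta> > 0"
    and segment: "\<And>x y z. (x, y) \<in> N \<Longrightarrow> y \<in> N0 \<Longrightarrow> norm (x - xs y) < \<delta> \<Longrightarrow>
                    z \<in> closed_segment (xs y) x \<Longrightarrow> (z, y) \<in> N"
    and B_pos: "B \<ge> 1"
    and g_bound: "\<And>p. p \<in> N \<Longrightarrow> norm (g p) \<le> B"
    and Df_bound: "\<And>p u. p \<in> N \<Longrightarrow> norm (frechet_derivative f (at p) u) \<le> B * norm u"
    and Dg_bound: "\<And>p u. p \<in> N \<Longrightarrow> norm (frechet_derivative g (at p) u) \<le> B * norm u"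
    and D2f_bound: "\<And>p u v. p \<in> N \<Longrightarrow> norm (second_derivative f p u v) \<le> B * norm u * norm v"
    and C_ge1: "C \<ge> 1" and a0_pos: "a0 > 0"
    and lyapunov: "\<And>y. y \<in> N0 \<Longrightarrow> (xs y, y) \<in> N \<Longrightarrow>
          \<exists>Q. lyapunov_for a0 C (\<lambda>u. frechet_derivative f (at (xs y, y)) (u, 0)) Q"
begin

text \<open>
  A bound for the derivative of \<open>xs\<close>: the factor \<open>2 * C / a0\<close> bounds the inverse of the fast Jacobian.
\<close>

definition graph_slope :: real where "graph_slope = 2 * C * B / a0"

text \<open>
  A bound for the speed at which the fast Jacobian changes along a solution.
\<close>

definition drift_rate :: real where "drift_rate = B\<^sup>2 * (graph_slope + 1)"

text \<open>
  The size, in units of \<open>\<epsilon>\<close>, of the layer around the graph in which the motion of \<open>xs y\<close> balances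
  the attraction. Any factor of at least \<open>sqrt 8\<close> in place of \<open>3\<close> would do.
\<close>

definition \<kappa> :: real where "\<kappa> = 3 * C * graph_slope * B / a0"

text \<open>
  Within this distance of the graph the quadratic remainder of \<open>f\<close> costs at most an eighth of the
  decay rate, and segments to the graph stay in \<open>N\<close>.
\<close>

definition \<rho> :: real where "\<rho> = min \<delta> (a0 / (16 * C * B))"

text \<open>
  The length of a window in units of \<open>\<epsilon>\<close>, chosen so that
  \<open>C * exp (- a0 * window / 4) = 1 / 2\<close>.
\<close>

definition window :: real where "window = 4 * ln (2 * C) / a0"

lemma constants_pos: "B > 0" "C > 0" "graph_slope > 0" "drift_rate > 0" "\<kappa> > 0" "\<rho> > 0" "window > 0"
proof -
  show B: "B > 0" and C: "C > 0" using B_pos C_ge1 by auto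
  show graph_slope: "graph_slope > 0" unfolding graph_slope_def using B C a0_pos by simp
  show "drift_rate > 0" "\<kappa> > 0" "\<rho> > 0" unfolding drift_rate_def \<kappa>_def \<rho>_def using B C graph_slope a0_pos \<delta>_pos by auto
  show "window > 0" unfolding window_def using C_ge1 a0_pos by simp
qed

lemma graph_in_N: "(x, y) \<in> N \<Longrightarrow> y \<in> N0 \<Longrightarrow> norm (x - xs y) < \<delta> \<Longrightarrow> (xs y, y) \<in> N"
  using segment by auto

text \<open>
  Differentiating \<open>f (xs y, y) = 0\<close> in direction \<open>v\<close> gives \<open>A w = - D_y f v\<close> for the derivative \<open>w\<close> of
  \<open>xs\<close>. The Lyapunov form makes \<open>A\<close> expansive from below:
  \<open>a0 / 2 * |w|^2 \<le> - Q w (A w) \<le> C |w| |A w|\<close>.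
\<close>

lemma xs_derivative_bound:
  assumes y: "y \<in> N0" and p: "(xs y, y) \<in> N"
  shows "norm (frechet_derivative xs (at y) v) \<le> graph_slope * norm v"
proof -
  let ?Df = "frechet_derivative f (at (xs y, y))"
  define w where "w = frechet_derivative xs (at y) v"
  have xs': "(xs has_derivative frechet_derivative xs (at y)) (at y)"
    using xs_diff[OF y] by (simp add: frechet_derivative_works)
  have f': "(f has_derivative ?Df) (at (xs y, y))"
    using f_diff[OF p] by (simp add: frechet_derivative_works)
  have comp: "((\<lambda>y. f (xs y, y)) has_derivative (\<lambda>v. ?Df (frechet_derivative xs (at y) v, v))) (at y)"
    using has_derivative_compose[OF has_derivative_Pair[OF xs' has_derivative_ident] f'] .
  have "isCont xs y" using xs' by (rule has_derivative_continuous)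
  then have "isCont (\<lambda>y. (xs y, y)) y" by (intro continuous_intros)
  then have "\<forall>\<^sub>F y' in at y. (xs y', y') \<in> N"
    using p open_N by (simp add: isCont_def topological_tendstoD)
  moreover have "\<forall>\<^sub>F y' in at y. y' \<in> N0"
    using open_N0 y by (rule eventually_at_in_open')
  ultimately have "\<forall>\<^sub>F y' in at y. 0 = f (xs y', y')"
    by eventually_elim (simp add: zero)
  then have "((\<lambda>y. f (xs y, y)) has_derivative (\<lambda>v. 0)) (at y)"
    by (rule has_derivative_transform_eventually[OF has_derivative_const])
       (simp_all add: zero[OF y p])
  from fun_cong[OF has_derivative_unique[OF comp this], of v]
  have "?Df (w, v) = 0" by (simp add: w_def)
  moreover have "?Df (w, v) = ?Df (w, 0) + ?Df (0, v)"
    using linear_add[OF has_derivative_linear[OF f'], of "(w, 0)" "(0, v)"] by simp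
  ultimately have "?Df (w, 0) = - ?Df (0, v)" by (simp add: eq_neg_iff_add_eq_0)
  then have "norm (?Df (w, 0)) = norm (?Df (0, v))" by simp
  then have A: "norm (?Df (w, 0)) \<le> B * norm v" using Df_bound[OF p, of "(0, v)"] by simp
  obtain Q where Q: "lyapunov_for a0 C (\<lambda>u. ?Df (u, 0)) Q" using lyapunov[OF y p] by blast
  have "a0 / 2 * (norm w)\<^sup>2 \<le> a0 / 2 * Q w w"
    using Q a0_pos by (simp add: lyapunov_for_def)
  also have "\<dots> \<le> \<bar>Q w (?Df (w, 0))\<bar>"
  proof -
    have "Q w (?Df (w, 0)) \<le> - (a0 / 2) * Q w w" using Q by (simp add: lyapunov_for_def)
    then show ?thesis by linarith
  qed
  also have "\<dots> \<le> C * (norm w * norm (?Df (w, 0)))" using Q by (simp add: lyapunov_for_def)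
  also have "\<dots> \<le> C * (norm w * (B * norm v))"
    using A constants_pos by (intro mult_left_mono) auto
  finally have "norm w * norm w \<le> norm w * (graph_slope * norm v)"
    using a0_pos by (simp add: graph_slope_def field_simps power2_eq_square)
  then show ?thesis
    using constants_pos unfolding w_def[symmetric] by (cases "w = 0") auto
qed

text \<open>
  Taylor estimates along the segment from \<open>xs y\<close> to \<open>x\<close>, which runs inside \<open>N\<close>, where the derivatives
  are bounded.
\<close>

lemma linearisation_error:
  assumes "(x, y) \<in> N" "y \<in> N0" "norm (x - xs y) < \<delta>"
  shows "norm (f (x, y) - frechet_derivative f (at (xs y, y)) (x - xs y, 0)) \<le> B * (norm (x - xs y))\<^sup>2"
    and "norm (g (x, y) - g (xs y, y)) \<le> B * norm (x - xs y)"
proof -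
  define z u p where "z = x - xs y" and "u = (z, 0 :: real^'m)" and "p \<theta> = (xs y + \<theta> *\<^sub>R z, y)" for \<theta> :: real
  let ?Df = "\<lambda>\<theta>. frechet_derivative f (at (p \<theta>)) u"
  have nu: "norm u = norm z" by (simp add: u_def)
  have pN: "p \<theta> \<in> N" if "\<theta> \<in> {0..1}" for \<theta>
  proof -
    have "xs y + \<theta> *\<^sub>R z \<in> closed_segment (xs y) x"
      using that by (auto simp: closed_segment_def z_def algebra_simps intro!: exI[of _ \<theta>])
    then show ?thesis unfolding p_def by (rule segment[OF assms])
  qed
  have p': "(p has_vector_derivative u) (at \<theta> within S)" for \<theta> S
    unfolding p_def u_def
    by (intro has_vector_derivative_Pair) (auto intro!: derivative_eq_intros)
  have Df': "(?Df has_vector_derivative second_derivative f (p \<theta>) u u) (at \<theta> within S)"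
    if "\<theta> \<in> {0..1}" for \<theta> S
    unfolding second_derivative_def
    by (rule differentiable_along_path[OF Df_diff[OF pN[OF that]] p'])
  have Df_var: "norm (?Df \<theta> - ?Df 0) \<le> B * (norm z)\<^sup>2" if "\<theta> \<in> {0..1}" for \<theta>
  proof -
    have "norm (?Df \<theta> - ?Df 0) \<le> (B * norm u * norm u) * (\<theta> - 0)"
      by (rule vector_mean_value[of 0 \<theta>], rule Df') (use that D2f_bound pN in auto)
    also have "\<dots> \<le> (B * norm u * norm u) * 1"
      using that constants_pos by (intro mult_left_mono) auto
    finally show ?thesis by (simp add: nu power2_eq_square)
  qed
  let ?h = "\<lambda>\<theta>. f (p \<theta>) - \<theta> *\<^sub>R ?Df 0"
  have "norm (?h 1 - ?h 0) \<le> B * (norm z)\<^sup>2 * (1 - 0)"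
  proof (rule vector_mean_value)
    fix \<theta> :: real assume \<theta>: "\<theta> \<in> {0..1}"
    have "((\<lambda>\<theta>. f (p \<theta>)) has_vector_derivative ?Df \<theta>) (at \<theta> within {0..1})"
      by (rule differentiable_along_path[OF f_diff[OF pN[OF \<theta>]] p'])
    then show "(?h has_vector_derivative ?Df \<theta> - ?Df 0) (at \<theta> within {0..1})"
      by (auto intro!: derivative_eq_intros)
  qed (use Df_var in auto)
  moreover have "p 0 = (xs y, y)" "p 1 = (x, y)" by (auto simp: p_def z_def)
  moreover have "f (xs y, y) = 0" using zero[OF assms(2) graph_in_N[OF assms]] .
  ultimately show "norm (f (x, y) - frechet_derivative f (at (xs y, y)) (x - xs y, 0)) \<le> B * (norm (x - xs y))\<^sup>2"
    by (simp add: u_def z_def)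
  have "norm (g (p 1) - g (p 0)) \<le> B * norm u * (1 - 0)"
  proof (rule vector_mean_value)
    fix \<theta> :: real assume \<theta>: "\<theta> \<in> {0..1}"
    show "((\<lambda>\<theta>. g (p \<theta>)) has_vector_derivative frechet_derivative g (at (p \<theta>)) u) (at \<theta> within {0..1})"
      by (rule differentiable_along_path[OF g_diff[OF pN[OF \<theta>]] p'])
  qed (use Dg_bound pN in auto)
  then show "norm (g (x, y) - g (xs y, y)) \<le> B * norm (x - xs y)"
    by (simp add: p_def z_def u_def)
qed

section \<open>Attraction to the slow manifold\<close>

text \<open>
  Derivatives are taken within the interval so that the notion restricts to subintervals.
\<close>

definition trajectory :: "real \<Rightarrow> real \<Rightarrow> real \<Rightarrow> (real \<Rightarrow> real^'n) \<Rightarrow> (real \<Rightarrow> real^'m) \<Rightarrow> bool" where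
  "trajectory \<epsilon> a b x y \<longleftrightarrow> (\<forall>t\<in>{a..b}. (x t, y t) \<in> N \<and> y t \<in> N0 \<and>
     (x has_vector_derivative (1 / \<epsilon>) *\<^sub>R f (x t, y t)) (at t within {a..b}) \<and>
     (y has_vector_derivative g (x t, y t)) (at t within {a..b}))"

lemma trajectory_mono:
  assumes "trajectory \<epsilon> a b x y" "a \<le> a'" "b' \<le> b"
  shows "trajectory \<epsilon> a' b' x y"
  unfolding trajectory_def
proof (intro ballI)
  fix t assume t: "t \<in> {a'..b'}"
  have sub: "{a'..b'} \<subseteq> {a..b}" using assms by auto
  with t assms(1) show "(x t, y t) \<in> N \<and> y t \<in> N0 \<and>
     (x has_vector_derivative (1 / \<epsilon>) *\<^sub>R f (x t, y t)) (at t within {a'..b'}) \<and>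
     (y has_vector_derivative g (x t, y t)) (at t within {a'..b'})"
    unfolding trajectory_def by (blast intro: has_vector_derivative_within_subset)
qed

text \<open>
  The fast Jacobian is \<open>Df\<close> along the curve \<open>(xs y, y)\<close>, whose speed is at most
  \<open>(graph_slope + 1) * B\<close>; the second derivative of \<open>f\<close> is bounded.
\<close>

lemma Jacobian_drift:
  assumes traj: "trajectory \<epsilon> a t x y" and "a \<le> t"
    and near: "\<And>s. s \<in> {a..t} \<Longrightarrow> norm (x s - xs (y s)) < \<delta>"
  shows "norm (frechet_derivative f (at (xs (y t), y t)) (u, 0)
            - frechet_derivative f (at (xs (y a), y a)) (u, 0)) \<le> drift_rate * norm u * (t - a)"
proof (rule vector_mean_value[OF _ _ \<open>a \<le> t\<close>])
  fix s assume s: "s \<in> {a..t}"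
  let ?q = "\<lambda>s. (xs (y s), y s)" and ?g = "g (x s, y s)"
  let ?q' = "(frechet_derivative xs (at (y s)) ?g, ?g)"
  have N: "(x s, y s) \<in> N" "y s \<in> N0" and y': "(y has_vector_derivative ?g) (at s within {a..t})"
    using traj s by (auto simp: trajectory_def)
  have qN: "?q s \<in> N" using graph_in_N[OF N near[OF s]] .
  have q': "(?q has_vector_derivative ?q') (at s within {a..t})"
    by (intro has_vector_derivative_Pair differentiable_along_path[OF xs_diff[OF N(2)] y'] y')
  show "((\<lambda>s. frechet_derivative f (at (?q s)) (u, 0)) has_vector_derivative
          second_derivative f (?q s) (u, 0) ?q') (at s within {a..t})"
    unfolding second_derivative_def
    by (rule differentiable_along_path[OF Df_diff[OF qN] q'])
  have "norm ?q' \<le> norm (frechet_derivative xs (at (y s)) ?g) + norm ?g"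
    using norm_triangle_ineq[of "(frechet_derivative xs (at (y s)) ?g, 0)" "(0, ?g)"] by simp
  also have "\<dots> \<le> graph_slope * norm ?g + norm ?g" using xs_derivative_bound[OF N(2) qN] by simp
  also have "\<dots> = (graph_slope + 1) * norm ?g" by (simp add: algebra_simps)
  also have "\<dots> \<le> (graph_slope + 1) * B" using g_bound[OF N(1)] constants_pos by (intro mult_left_mono) auto
  finally have q'_le: "norm ?q' \<le> (graph_slope + 1) * B" .
  have "norm (second_derivative f (?q s) (u, 0) ?q') \<le> B * norm (u, 0 :: real^'m) * norm ?q'"
    by (rule D2f_bound[OF qN])
  also have "\<dots> \<le> B * norm (u, 0 :: real^'m) * ((graph_slope + 1) * B)"
    using constants_pos by (intro mult_left_mono q'_le) auto
  also have "\<dots> = drift_rate * norm u" by (simp add: drift_rate_def power2_eq_square)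
  finally show "norm (second_derivative f (?q s) (u, 0) ?q') \<le> drift_rate * norm u" .
qed

text \<open>
  The form \<open>Q\<close> belongs to the Jacobian at the start of the window. Its value \<open>\<phi>\<close> at \<open>z\<close> would decay at
  rate \<open>a0 / \<epsilon>\<close> under the linear flow of that Jacobian; the drift of the Jacobian, the quadratic
  remainder of \<open>f\<close> and the motion of \<open>xs y\<close> together use up half of this rate and leave a source
  term of order \<open>\<epsilon>\<close>.
\<close>

lemma decay_on_window_aux:
  assumes traj: "trajectory \<epsilon> a b x y" and ab: "a \<le> b" and \<epsilon>: "\<epsilon> > 0"
    and short: "b - a \<le> \<epsilon> * window" "\<epsilon> * window * drift_rate \<le> a0 / (16 * C)"
    and start: "C * norm (x a - xs (y a)) + \<kappa> * \<epsilon> < \<rho>" and t: "t \<in> {a..b}"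
    and Q: "lyapunov_for a0 C (\<lambda>u. frechet_derivative f (at (xs (y a), y a)) (u, 0)) Q"
  shows "norm (x t - xs (y t)) \<le> C * norm (x a - xs (y a)) * exp (- a0 * (t - a) / (4 * \<epsilon>)) + \<kappa> * \<epsilon>"
proof -
  note pos = constants_pos a0_pos
  define z where "z t = x t - xs (y t)" for t
  define A where "A t u = frechet_derivative f (at (xs (y t), y t)) (u, 0)" for t u
  define z' where "z' t = (1 / \<epsilon>) *\<^sub>R f (x t, y t) - frechet_derivative xs (at (y t)) (g (x t, y t))" for t
  have N: "(x t, y t) \<in> N" "y t \<in> N0" if "t \<in> {a..b}" for t
    using traj that by (auto simp: trajectory_def)
  have z': "(z has_vector_derivative z' t) (at t within {a..b})" if "t \<in> {a..b}" for t
    unfolding z_def z'_def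
    by (intro has_vector_derivative_diff differentiable_along_path xs_diff N that)
       (use traj that in \<open>auto simp: trajectory_def\<close>)
  have \<rho>\<delta>: "\<rho> \<le> \<delta>" and \<rho>B: "\<rho> * B \<le> a0 / (16 * C)"
    using pos by (auto simp: \<rho>_def min_def field_simps)
  have Q_bil: "bounded_bilinear Q" using Q by (simp add: lyapunov_for_def)
  have Q': "lyapunov_for a0 C (A a) Q" using Q unfolding A_def .
  have Q_sym: "Q u v = Q v u" and Q_low: "(norm v)\<^sup>2 \<le> Q v v"
    and Q_up: "\<bar>Q u v\<bar> \<le> C * (norm u * norm v)" and Q_A: "Q v (A a v) \<le> - (a0 / 2) * Q v v" for u v
    using Q' by (auto simp: lyapunov_for_def)
  define \<phi> where "\<phi> t = Q (z t) (z t)" for t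
  define \<alpha> \<beta> where "\<alpha> = a0 / (2 * \<epsilon>)" and "\<beta> = 4 / a0 * (C * graph_slope * B)\<^sup>2 * \<epsilon>"
  have \<phi>': "(\<phi> has_vector_derivative 2 * Q (z t) (z' t)) (at t within {a..b})" if "t \<in> {a..b}" for t
    unfolding \<phi>_def using bounded_bilinear.has_vector_derivative[OF Q_bil z'[OF that] z'[OF that]]
    by (simp add: Q_sym[of "z' t"])
  (* epsilon * z' is the frozen linear part plus the remainder r; Young's inequality absorbs r *)
  have growth: "2 * Q (z t) (z' t) \<le> - \<alpha> * \<phi> t + \<beta>"
    if t: "t \<in> {a<..<b}" and R: "\<And>s. s \<in> {a..t} \<Longrightarrow> \<phi> s < \<rho>\<^sup>2" for t
  proof -
    have tab: "t \<in> {a..b}" using t by auto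
    have z_less: "norm (z s) < \<rho>" if "s \<in> {a..t}" for s
      using R[OF that] Q_low[of "z s"] pos unfolding \<phi>_def
      by (meson le_less_trans less_imp_le power_less_imp_less_base)
    let ?n = "norm (z t)"
    have zt: "?n < \<rho>" using z_less[of t] t by simp
    have near: "norm (x s - xs (y s)) < \<delta>" if "s \<in> {a..t}" for s
      using z_less[OF that] \<rho>\<delta> by (simp add: z_def)
    have tN: "norm (x t - xs (y t)) < \<delta>" using near[of t] t by simp
    note gN = graph_in_N[OF N[OF tab] tN]
    define r where "r = \<epsilon> *\<^sub>R z' t - A a (z t)"
    have "r = (A t (z t) - A a (z t)) + (f (x t, y t) - A t (z t))
              - \<epsilon> *\<^sub>R frechet_derivative xs (at (y t)) (g (x t, y t))"
      using \<epsilon> by (simp add: r_def z'_def algebra_simps)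
    also have "norm \<dots> \<le> norm (A t (z t) - A a (z t)) + norm (f (x t, y t) - A t (z t))
              + norm (\<epsilon> *\<^sub>R frechet_derivative xs (at (y t)) (g (x t, y t)))"
      by (meson add_right_mono norm_triangle_ineq norm_triangle_ineq4 order_trans)
    also have "\<dots> \<le> (?n * (a0 / (16 * C)) + ?n * (a0 / (16 * C))) + \<epsilon> * (graph_slope * B)"
    proof (intro add_mono)
      have "norm (A t (z t) - A a (z t)) \<le> drift_rate * ?n * (t - a)"
        unfolding A_def using trajectory_mono[OF traj order_refl, of t] t near
          by (intro Jacobian_drift[of \<epsilon> a t x y]) auto
      also have "\<dots> \<le> drift_rate * ?n * (\<epsilon> * window)" using t short(1) pos by (intro mult_left_mono) auto
      also have "\<dots> = ?n * (\<epsilon> * window * drift_rate)" by simp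
      also have "\<dots> \<le> ?n * (a0 / (16 * C))" using short(2) by (intro mult_left_mono) auto
      finally show "norm (A t (z t) - A a (z t)) \<le> ?n * (a0 / (16 * C))" .
      have "norm (f (x t, y t) - A t (z t)) \<le> B * ?n\<^sup>2"
        unfolding A_def z_def by (rule linearisation_error(1)[OF N[OF tab] tN])
      also have "\<dots> = ?n * (?n * B)" by (simp add: power2_eq_square)
      also have "\<dots> \<le> ?n * (\<rho> * B)" using zt pos by (intro mult_left_mono mult_right_mono) auto
      also have "\<dots> \<le> ?n * (a0 / (16 * C))" using \<rho>B by (intro mult_left_mono) auto
      finally show "norm (f (x t, y t) - A t (z t)) \<le> ?n * (a0 / (16 * C))" .
      have "norm (frechet_derivative xs (at (y t)) (g (x t, y t))) \<le> graph_slope * norm (g (x t, y t))"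
        by (rule xs_derivative_bound[OF N(2)[OF tab] gN])
      also have "\<dots> \<le> graph_slope * B" using g_bound[OF N(1)[OF tab]] pos by (intro mult_left_mono) auto
      finally show "norm (\<epsilon> *\<^sub>R frechet_derivative xs (at (y t)) (g (x t, y t))) \<le> \<epsilon> * (graph_slope * B)"
        using \<epsilon> by simp
    qed
    also have "?n * (a0 / (16 * C)) + ?n * (a0 / (16 * C)) = ?n * (a0 / (8 * C))"
      by (simp add: field_simps)
    finally have r_le: "norm r \<le> ?n * (a0 / (8 * C)) + \<epsilon> * (graph_slope * B)" .
    have "2 * Q (z t) r \<le> 2 * (C * (?n * norm r))" using Q_up[of "z t" r] by simp
    also have "\<dots> \<le> 2 * (C * (?n * (?n * (a0 / (8 * C)) + \<epsilon> * (graph_slope * B))))"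
      using r_le pos by (intro mult_left_mono) auto
    also have "\<dots> = a0 / 4 * ?n\<^sup>2 + 2 * ?n * (\<epsilon> * (C * graph_slope * B))"
      using pos by (simp add: field_simps power2_eq_square)
    also have "2 * ?n * (\<epsilon> * (C * graph_slope * B)) \<le> a0 / 4 * ?n\<^sup>2 + \<epsilon> * \<beta>"
      using zero_le_power2[of "a0 / 2 * ?n - 2 * (\<epsilon> * (C * graph_slope * B))"] pos
      unfolding \<beta>_def by (simp add: power2_eq_square field_simps)
    finally have Qr: "2 * Q (z t) r \<le> a0 / 2 * ?n\<^sup>2 + \<epsilon> * \<beta>" by simp
    have "\<epsilon> *\<^sub>R z' t = A a (z t) + r" by (simp add: r_def)
    then have "\<epsilon> * (2 * Q (z t) (z' t)) = 2 * Q (z t) (A a (z t)) + 2 * Q (z t) r"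
      using bounded_bilinear.scaleR_right[OF Q_bil, of "z t" \<epsilon> "z' t"] by (simp add: bounded_bilinear.add_right[OF Q_bil])
    also have "\<dots> \<le> - a0 * \<phi> t + (a0 / 2 * \<phi> t + \<epsilon> * \<beta>)"
    proof -
      have "a0 / 2 * ?n\<^sup>2 \<le> a0 / 2 * Q (z t) (z t)"
        using Q_low[of "z t"] pos by (intro mult_left_mono) auto
      then show ?thesis using Q_A[of "z t"] Qr unfolding \<phi>_def by linarith
    qed
    also have "\<dots> = \<epsilon> * (- \<alpha> * \<phi> t + \<beta>)" using \<epsilon> by (simp add: \<alpha>_def field_simps)
    finally show ?thesis using \<epsilon> by simp
  qed
  have ratio: "\<beta> / \<alpha> \<le> (\<kappa> * \<epsilon>)\<^sup>2"
    using pos \<epsilon> by (simp add: \<alpha>_def \<beta>_def \<kappa>_def power2_eq_square field_simps)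
  have \<phi>a: "\<phi> a \<le> (C * norm (z a))\<^sup>2"
  proof -
    have "\<phi> a \<le> C * (norm (z a) * norm (z a))" using Q_up[of "z a" "z a"] by (simp add: \<phi>_def)
    also have "\<dots> \<le> C * (C * (norm (z a) * norm (z a)))"
      using pos mult_right_mono[OF C_ge1, of "norm (z a) * norm (z a)"]
      by (intro mult_left_mono) auto
    finally show ?thesis by (simp add: power2_eq_square algebra_simps)
  qed
  have sum_sq: "p\<^sup>2 + q\<^sup>2 \<le> (p + q)\<^sup>2" if "p \<ge> 0" "q \<ge> 0" for p q :: real
    using mult_nonneg_nonneg[OF that] by (simp add: power2_eq_square algebra_simps)
  have \<phi>_bound: "\<phi> t \<le> \<phi> a * exp (- \<alpha> * (t - a)) + \<beta> / \<alpha>"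
  proof (rule barrier_decay[of a b \<phi> "\<lambda>t. 2 * Q (z t) (z' t)" "\<rho>\<^sup>2"])
    show "continuous_on {a..b} \<phi>"
      using has_vector_derivative_continuous[OF \<phi>'] by (simp add: continuous_on_eq_continuous_within)
    fix t assume t: "t \<in> {a<..<b}"
    then show "(\<phi> has_real_derivative 2 * Q (z t) (z' t)) (at t)"
      using \<phi>'[of t] by (simp add: at_within_Icc_at has_real_derivative_iff_has_vector_derivative)
    assume "\<And>s. s \<in> {a..t} \<Longrightarrow> \<phi> s < \<rho>\<^sup>2"
    then show "2 * Q (z t) (z' t) \<le> - \<alpha> * \<phi> t + \<beta>" by (rule growth[OF t])
  next
    have "\<phi> a + \<beta> / \<alpha> \<le> (C * norm (z a))\<^sup>2 + (\<kappa> * \<epsilon>)\<^sup>2" using \<phi>a ratio by (rule add_mono)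
    also have "\<dots> \<le> (C * norm (z a) + \<kappa> * \<epsilon>)\<^sup>2" using pos \<epsilon> by (intro sum_sq) auto
    also have "\<dots> < \<rho>\<^sup>2" using start pos \<epsilon> unfolding z_def by (intro power_strict_mono) auto
    finally show "\<phi> a + \<beta> / \<alpha> < \<rho>\<^sup>2" .
    show "\<phi> a \<ge> 0" using Q_low[of "z a"] zero_le_power2[of "norm (z a)"] unfolding \<phi>_def by linarith
  qed (use pos \<epsilon> t in \<open>auto simp: \<alpha>_def \<beta>_def\<close>)
  let ?e = "exp (- a0 * (t - a) / (4 * \<epsilon>))"
  have e2: "exp (- \<alpha> * (t - a)) = ?e\<^sup>2"
    by (simp add: exp_double[symmetric] \<alpha>_def)
  have "(norm (z t))\<^sup>2 \<le> (C * norm (z a))\<^sup>2 * ?e\<^sup>2 + (\<kappa> * \<epsilon>)\<^sup>2"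
  proof -
    have "\<phi> a * ?e\<^sup>2 \<le> (C * norm (z a))\<^sup>2 * ?e\<^sup>2" by (intro mult_right_mono \<phi>a) auto
    then show ?thesis using Q_low[of "z t"] \<phi>_bound ratio unfolding e2 \<phi>_def by linarith
  qed
  also have "\<dots> \<le> (C * norm (z a) * ?e + \<kappa> * \<epsilon>)\<^sup>2"
    unfolding power_mult_distrib[symmetric, of "C * norm (z a)"] using pos \<epsilon> by (intro sum_sq) auto
  finally have "norm (z t) \<le> C * norm (z a) * ?e + \<kappa> * \<epsilon>"
    by (rule power2_le_imp_le) (use pos \<epsilon> in auto)
  then show ?thesis unfolding z_def .
qed

text \<open>
  At the start of the window the graph point above \<open>y a\<close> lies in \<open>N\<close>, so a form is available there.
\<close>

lemma decay_on_window:
  assumes traj: "trajectory \<epsilon> a b x y" and ab: "a \<le> b" and \<epsilon>: "\<epsilon> > 0"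
    and short: "b - a \<le> \<epsilon> * window" "\<epsilon> * window * drift_rate \<le> a0 / (16 * C)"
    and start: "C * norm (x a - xs (y a)) + \<kappa> * \<epsilon> < \<rho>" and t: "t \<in> {a..b}"
  shows "norm (x t - xs (y t)) \<le> C * norm (x a - xs (y a)) * exp (- a0 * (t - a) / (4 * \<epsilon>)) + \<kappa> * \<epsilon>"
proof -
  let ?n = "norm (x a - xs (y a))"
  have a: "(x a, y a) \<in> N" "y a \<in> N0" using traj ab by (auto simp: trajectory_def)
  have "?n \<le> C * ?n" using mult_right_mono[OF C_ge1, of ?n] by simp
  moreover have "\<kappa> * \<epsilon> > 0" using constants_pos \<epsilon> by simp
  ultimately have "?n < \<delta>" using start unfolding \<rho>_def by linarith
  then obtain Q where "lyapunov_for a0 C (\<lambda>u. frechet_derivative f (at (xs (y a), y a)) (u, 0)) Q"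
    using lyapunov[OF a(2) graph_in_N[OF a]] by blast
  then show ?thesis by (rule decay_on_window_aux[OF assms])
qed

text \<open>
  Over a full window \<open>|z|\<close> is halved up to \<open>\<kappa> * \<epsilon>\<close>, so after \<open>n\<close> windows it is at most
  \<open>(1/2)^n * |z 0| + 2 * \<kappa> * \<epsilon>\<close>. The smallness hypotheses leave room for the factor \<open>C\<close> that is lost when the
  form is changed, and for the last, incomplete window.
\<close>

lemma slow_manifold_attraction:
  assumes traj: "trajectory \<epsilon> 0 t x y" and t0: "t \<ge> 0" and \<epsilon>: "\<epsilon> > 0"
    and small: "\<epsilon> * window * drift_rate \<le> a0 / (16 * C)" "3 * C * \<kappa> * \<epsilon> < \<rho> / 2"
    and start: "norm (x 0 - xs (y 0)) < \<rho> / (4 * C)"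
  shows "norm (x t - xs (y t))
           \<le> 3 * C * \<kappa> * \<epsilon> + 2 * C * norm (x 0 - xs (y 0)) * exp (- (ln 2 / window) * t / \<epsilon>)"
    and "norm (x t - xs (y t)) < \<delta>"
proof -
  note pos = constants_pos a0_pos
  define z where "z t = x t - xs (y t)" for t
  define d where "d = norm (z 0)"
  define h where "h = \<epsilon> * window"
  have h: "h > 0" using \<epsilon> pos by (simp add: h_def)
  have k\<epsilon>: "\<kappa> * \<epsilon> > 0" using pos \<epsilon> by simp
  have k\<epsilon>C: "\<kappa> * \<epsilon> \<le> C * (\<kappa> * \<epsilon>)" using mult_right_mono[OF C_ge1, of "\<kappa> * \<epsilon>"] k\<epsilon> by simp
  have Cd: "C * d < \<rho> / 4" using start pos by (simp add: d_def z_def field_simps)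
  (* the defining property of the window length *)
  have half: "C * exp (- a0 * h / (4 * \<epsilon>)) = 1 / 2"
  proof -
    have "- a0 * h / (4 * \<epsilon>) = - ln (2 * C)"
      using \<epsilon> pos by (simp add: h_def window_def)
    then show ?thesis using pos by (simp add: exp_minus)
  qed
  (* every bound of this shape permits the start of another window *)
  have room: "C * w + \<kappa> * \<epsilon> < \<rho>" if w: "w \<le> (1 / 2) ^ n * d + 2 * (\<kappa> * \<epsilon>)" for w and n :: nat
  proof -
    have "(1 / 2) ^ n * d \<le> 1 * d"
      by (intro mult_right_mono power_le_one) (auto simp: d_def)
    then have "C * w \<le> C * (d + 2 * (\<kappa> * \<epsilon>))" using w pos by (intro mult_left_mono) auto
    then show ?thesis using Cd small(2) k\<epsilon>C pos by (simp add: algebra_simps)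
  qed
  have iter: "norm (z (real n * h)) \<le> (1 / 2) ^ n * d + 2 * (\<kappa> * \<epsilon>)" if "real n * h \<le> t" for n
    using that
  proof (induction n)
    case 0
    then show ?case using k\<epsilon> by (simp add: d_def)
  next
    case (Suc n)
    let ?a = "real n * h" and ?b = "real (Suc n) * h"
    have ab: "?b = ?a + h" by (simp add: algebra_simps)
    have IH: "norm (z ?a) \<le> (1 / 2) ^ n * d + 2 * (\<kappa> * \<epsilon>)" using Suc ab h by auto
    have "norm (z ?b) \<le> C * norm (z ?a) * exp (- a0 * (?b - ?a) / (4 * \<epsilon>)) + \<kappa> * \<epsilon>"
      unfolding z_def
    proof (rule decay_on_window[OF _ _ \<epsilon> _ small(1)])
      show "trajectory \<epsilon> ?a ?b x y"
        using traj Suc.prems h by (intro trajectory_mono[OF traj]) auto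
      show "C * norm (x ?a - xs (y ?a)) + \<kappa> * \<epsilon> < \<rho>"
        using room[OF IH] by (simp add: z_def)
    qed (use h ab in \<open>auto simp: h_def[symmetric]\<close>)
    also have "C * norm (z ?a) * exp (- a0 * (?b - ?a) / (4 * \<epsilon>)) = norm (z ?a) * (C * exp (- a0 * h / (4 * \<epsilon>)))"
      using ab by simp
    also have "\<dots> = norm (z ?a) / 2" unfolding half by simp
    finally show ?case using IH by simp
  qed
  define n where "n = nat \<lfloor>t / h\<rfloor>"
  have n: "real n \<le> t / h" "t / h < real n + 1"
    using t0 h by (simp_all add: n_def)
  then have nh: "real n * h \<le> t" "t < real n * h + h" using h by (simp_all add: field_simps)
  have zn: "norm (z (real n * h)) \<le> (1 / 2) ^ n * d + 2 * (\<kappa> * \<epsilon>)" by (rule iter[OF nh(1)])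
  have "norm (z t) \<le> C * norm (z (real n * h)) * exp (- a0 * (t - real n * h) / (4 * \<epsilon>)) + \<kappa> * \<epsilon>"
    unfolding z_def
  proof (rule decay_on_window[OF _ _ \<epsilon> _ small(1)])
    show "trajectory \<epsilon> (real n * h) t x y" using h by (intro trajectory_mono[OF traj]) auto
    show "C * norm (x (real n * h) - xs (y (real n * h))) + \<kappa> * \<epsilon> < \<rho>"
      using room[OF zn] by (simp add: z_def)
  qed (use nh in \<open>auto simp: h_def[symmetric]\<close>)
  also have "\<dots> \<le> C * norm (z (real n * h)) * 1 + \<kappa> * \<epsilon>"
    using nh pos \<epsilon> by (intro add_mono mult_left_mono) (auto simp: divide_nonpos_pos mult_nonneg_nonneg)
  finally have zt: "norm (z t) \<le> C * norm (z (real n * h)) + \<kappa> * \<epsilon>" by simp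
  show "norm (x t - xs (y t)) < \<delta>"
    using zt room[OF zn] by (simp add: z_def \<rho>_def)
  have "(1 / 2 :: real) ^ Suc n = exp (- ln 2 * real (Suc n))"
    using exp_of_nat_mult[of "Suc n" "- ln 2 :: real"]
    by (simp only: mult.commute[of "- ln 2"]) (simp add: exp_minus field_simps)
  also have "\<dots> \<le> exp (- (ln 2 / window) * t / \<epsilon>)"
  proof -
    have "t / h * ln 2 \<le> real (Suc n) * ln 2" using n by (intro mult_right_mono) auto
    then show ?thesis by (simp add: h_def mult.commute)
  qed
  finally have "(1 / 2) ^ n \<le> 2 * exp (- (ln 2 / window) * t / \<epsilon>)" by simp
  then have "(1 / 2) ^ n * d \<le> 2 * exp (- (ln 2 / window) * t / \<epsilon>) * d"
    by (intro mult_right_mono) (auto simp: d_def)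
  with zn have "C * norm (z (real n * h)) \<le> C * (2 * exp (- (ln 2 / window) * t / \<epsilon>) * d + 2 * (\<kappa> * \<epsilon>))"
    using pos by (intro mult_left_mono) auto
  with zt k\<epsilon>C show "norm (x t - xs (y t))
           \<le> 3 * C * \<kappa> * \<epsilon> + 2 * C * norm (x 0 - xs (y 0)) * exp (- (ln 2 / window) * t / \<epsilon>)"
    by (simp add: z_def d_def algebra_simps)
qed

section \<open>Comparison with the reduced dynamics\<close>

text \<open>
  The norm of \<open>w = y - y0\<close> need not be differentiable where \<open>w = 0\<close>, so Gronwall's argument is run on
  \<open>sqrt (|w|^2 + \<epsilon>^2)\<close>; this regularisation starts at \<open>\<epsilon>\<close> and costs only the summand \<open>1\<close> in
  the constant. The two extra terms of the decreasing function \<open>\<Psi>\<close> are antiderivatives, up to sign,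
  of bounds for the source terms.
\<close>

lemma reduced_dynamics_error:
  assumes traj: "trajectory \<epsilon> 0 t x y" and t0: "t \<ge> 0" and \<epsilon>: "\<epsilon> > 0"
    and c: "c1 \<ge> 0" "c2 \<ge> 0" "K0 > 0" "d \<ge> 0"
    and fast: "\<And>s. s \<in> {0..t} \<Longrightarrow> norm (x s - xs (y s)) \<le> c1 * \<epsilon> + c2 * d * exp (- K0 * s / \<epsilon>)"
    and near: "\<And>s. s \<in> {0..t} \<Longrightarrow> norm (x s - xs (y s)) < \<delta>"
    and red: "\<And>s. s \<in> {0..t} \<Longrightarrow> y0 s \<in> N0 \<and>
                (y0 has_vector_derivative reduced_field g xs (y0 s)) (at s within {0..t})"
    and init: "y0 0 = y 0" and K1: "K1 > 0" "K1-lipschitz_on N0 (reduced_field g xs)"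
  shows "norm (y t - y0 t) \<le> (1 + B * c1 / K1 + B * c2 * d / K0) * \<epsilon> * exp (K1 * t)"
proof -
  note pos = constants_pos
  define w where "w s = y s - y0 s" for s
  define w' where "w' s = g (x s, y s) - reduced_field g xs (y0 s)" for s
  define m where "m s = B * (c1 * \<epsilon> + c2 * d * exp (- K0 * s / \<epsilon>))" for s
  define \<nu> where "\<nu> s = sqrt (w s \<bullet> w s + \<epsilon>\<^sup>2)" for s
  have N: "(x s, y s) \<in> N" "y s \<in> N0" if "s \<in> {0..t}" for s
    using traj that by (auto simp: trajectory_def)
  have w': "(w has_vector_derivative w' s) (at s within {0..t})" if "s \<in> {0..t}" for s
    unfolding w_def w'_def using traj red[OF that] that
    by (intro has_vector_derivative_diff) (auto simp: trajectory_def)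
  have w'_le: "norm (w' s) \<le> m s + K1 * norm (w s)" if s: "s \<in> {0..t}" for s
  proof -
    have "w' s = (g (x s, y s) - g (xs (y s), y s)) + (reduced_field g xs (y s) - reduced_field g xs (y0 s))"
      by (simp add: w'_def reduced_field_def)
    also have "norm \<dots> \<le> B * norm (x s - xs (y s)) + K1 * norm (y s - y0 s)"
      using linearisation_error(2)[OF N[OF s] near[OF s]] lipschitz_onD[OF K1(2) N(2)[OF s], of "y0 s"] red[OF s]
      by (intro norm_triangle_mono) (auto simp: dist_norm)
    also have "\<dots> \<le> m s + K1 * norm (w s)"
      unfolding m_def w_def using fast[OF s] pos by (intro add_right_mono mult_left_mono) auto
    finally show ?thesis .
  qed
  have sq_pos: "w s \<bullet> w s + \<epsilon>\<^sup>2 > 0" for s using \<epsilon> by (simp add: add_nonneg_pos)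
  have \<nu>_pos: "\<nu> s > 0" for s using sq_pos by (simp add: \<nu>_def)
  have w_le: "norm (w s) \<le> \<nu> s" for s
    unfolding \<nu>_def norm_eq_sqrt_inner by simp
  let ?\<Psi> = "\<lambda>s. \<nu> s * exp (- K1 * s) + B * c1 * \<epsilon> / K1 * exp (- K1 * s)
                 + B * c2 * d * \<epsilon> / K0 * exp (- K0 * s / \<epsilon>)"
  have "?\<Psi> t \<le> ?\<Psi> 0"
  proof (rule DERIV_nonpos_imp_decreasing_open[of 0 t ?\<Psi>, OF t0])
    have "continuous_on {0..t} w"
      using has_vector_derivative_continuous[OF w'] by (simp add: continuous_on_eq_continuous_within)
    then show "continuous_on {0..t} ?\<Psi>" unfolding \<nu>_def
      using \<epsilon> by (intro continuous_intros) auto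
    fix s assume s: "0 < s" "s < t"
    then have s': "s \<in> {0..t}" by simp
    have ws: "(w has_vector_derivative w' s) (at s)" using w'[OF s'] s by (simp add: at_within_Icc_at)
    have "((\<lambda>s. w s \<bullet> w s) has_vector_derivative (w s \<bullet> w' s + w' s \<bullet> w s)) (at s)"
      by (rule bounded_bilinear.has_vector_derivative[OF bounded_bilinear_inner ws ws])
    then have "((\<lambda>s. w s \<bullet> w s) has_real_derivative 2 * (w s \<bullet> w' s)) (at s)"
      by (simp add: has_real_derivative_iff_has_vector_derivative inner_commute)
    from DERIV_add[OF this DERIV_const[of "\<epsilon>\<^sup>2"]]
    have "((\<lambda>s. w s \<bullet> w s + \<epsilon>\<^sup>2) has_real_derivative 2 * (w s \<bullet> w' s)) (at s)" by simp
    from DERIV_chain2[of sqrt, OF DERIV_real_sqrt[OF sq_pos[of s]] this]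
    have "((\<lambda>s. sqrt (w s \<bullet> w s + \<epsilon>\<^sup>2)) has_real_derivative
             inverse (\<nu> s) / 2 * (2 * (w s \<bullet> w' s))) (at s)"
      by (simp only: \<nu>_def)
    moreover have "\<nu> = (\<lambda>s. sqrt (w s \<bullet> w s + \<epsilon>\<^sup>2))" by (simp add: \<nu>_def fun_eq_iff)
    moreover have "inverse (\<nu> s) / 2 * (2 * (w s \<bullet> w' s)) = (w s \<bullet> w' s) / \<nu> s"
      by (simp add: field_simps)
    ultimately have \<nu>': "(\<nu> has_real_derivative (w s \<bullet> w' s) / \<nu> s) (at s)"
      by (simp only:)
    have exp': "((\<lambda>s. exp (c * s)) has_real_derivative c * exp (c * s)) (at s)" for c :: real
      using DERIV_chain2[OF DERIV_exp DERIV_cmult_Id[of c s UNIV]] by (simp add: mult.commute)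
    let ?D = "(w s \<bullet> w' s / \<nu> s - K1 * \<nu> s) * exp (- K1 * s) - B * c1 * \<epsilon> * exp (- K1 * s)
                - B * c2 * d * exp (- K0 * s / \<epsilon>)"
    have "(?\<Psi> has_real_derivative
        ((w s \<bullet> w' s) / \<nu> s * exp (- K1 * s) + - K1 * exp (- K1 * s) * \<nu> s)
          + B * c1 * \<epsilon> / K1 * (- K1 * exp (- K1 * s))
          + B * c2 * d * \<epsilon> / K0 * (- K0 / \<epsilon> * exp (- K0 / \<epsilon> * s))) (at s)"
      using exp'[of "- K0 / \<epsilon>"]
      by (intro DERIV_add DERIV_mult[OF \<nu>' exp'] DERIV_cmult exp') simp
    moreover have "((w s \<bullet> w' s) / \<nu> s * exp (- K1 * s) + - K1 * exp (- K1 * s) * \<nu> s)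
          + B * c1 * \<epsilon> / K1 * (- K1 * exp (- K1 * s))
          + B * c2 * d * \<epsilon> / K0 * (- K0 / \<epsilon> * exp (- K0 / \<epsilon> * s)) = ?D"
      using K1 c \<epsilon> by (simp add: left_diff_distrib)
    ultimately have "(?\<Psi> has_real_derivative ?D) (at s)" by (simp only:)
    moreover have "?D \<le> 0"
    proof -
      have "w s \<bullet> w' s \<le> norm (w s) * norm (w' s)" by (rule norm_cauchy_schwarz)
      also have "\<dots> \<le> \<nu> s * (m s + K1 * \<nu> s)"
        using w_le[of s] w'_le[OF s'] K1 \<nu>_pos[of s]
        by (intro mult_mono) (auto intro: order_trans[OF _ add_left_mono[OF mult_left_mono]])
      finally have "w s \<bullet> w' s / \<nu> s - K1 * \<nu> s \<le> m s"
        using \<nu>_pos[of s] by (simp add: field_simps)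
      then have "(w s \<bullet> w' s / \<nu> s - K1 * \<nu> s) * exp (- K1 * s) \<le> m s * exp (- K1 * s)"
        by (rule mult_right_mono) simp
      also have "\<dots> = B * c1 * \<epsilon> * exp (- K1 * s) + B * c2 * d * exp (- K0 * s / \<epsilon>) * exp (- K1 * s)"
        by (simp add: m_def algebra_simps)
      also have "B * c2 * d * exp (- K0 * s / \<epsilon>) * exp (- K1 * s) \<le> B * c2 * d * exp (- K0 * s / \<epsilon>) * 1"
        using K1 s c pos by (intro mult_left_mono) auto
      finally show ?thesis by simp
    qed
    ultimately show "\<exists>D. (?\<Psi> has_real_derivative D) (at s) \<and> D \<le> 0" by blast
  qed
  moreover have "\<nu> 0 = \<epsilon>" using \<epsilon> by (simp add: \<nu>_def w_def init)
  moreover have "B * c1 * \<epsilon> / K1 * exp (- K1 * t) \<ge> 0" "B * c2 * d * \<epsilon> / K0 * exp (- K0 * t / \<epsilon>) \<ge> 0"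
    using pos c K1 \<epsilon> by auto
  ultimately have "\<nu> t * exp (- K1 * t) \<le> \<epsilon> + B * c1 * \<epsilon> / K1 + B * c2 * d * \<epsilon> / K0" by simp
  also have "\<dots> = (1 + B * c1 / K1 + B * c2 * d / K0) * \<epsilon>" by (simp add: algebra_simps)
  finally have "\<nu> t \<le> (1 + B * c1 / K1 + B * c2 * d / K0) * \<epsilon> * exp (K1 * t)"
    by (simp add: exp_minus field_simps)
  then show ?thesis using w_le[of t] by (simp add: w_def)
qed

end

section \<open>Tracking estimates for stable slow manifolds\<close>

lemma Ck_on_differentiable:
  assumes "Ck_on (Suc (Suc k)) S F" "p \<in> S"
  shows "F differentiable (at p)" and "(\<lambda>q. frechet_derivative F (at q) u) differentiable (at p)"
  using assms by (simp_all del: split_paired_All)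

theorem theorem4p1p2:
  fixes D N :: "((real^'n) \<times> (real^'m)) set"
    and N0 :: "(real^'m) set"
    and f :: "(real^'n) \<times> (real^'m) \<Rightarrow> real^'n"
    and g :: "(real^'n) \<times> (real^'m) \<Rightarrow> real^'m"
    and xs :: "real^'m \<Rightarrow> real^'n"
    and r :: nat and a0 :: real
  assumes "open D" and "connected D"
    and "r \<ge> 2" and "Ck_on r D f" and "Ck_on r D g"
    and "open N" and "N \<subseteq> D"
    and "open N0" and "Ck_on r N0 xs"
    and graph_in_D: "\<And>y. y \<in> N0 \<Longrightarrow> (xs y, y) \<in> D"
    and zero_set: "\<And>x y. (x, y) \<in> N \<Longrightarrow> f (x, y) = 0 \<longleftrightarrow> y \<in> N0 \<and> x = xs y"
    and near_graph: "segments_near_graph N N0 xs"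
    and det_bound: "\<exists>d>0. \<forall>y\<in>N0. (xs y, y) \<in> N \<longrightarrow> d \<le> \<bar>det (fast_jacobian f xs y)\<bar>"
    and "a0 > 0"
    and stable: "\<And>y a. y \<in> N0 \<Longrightarrow> eigenvalue_of (fast_jacobian f xs y) a \<Longrightarrow> Re a \<le> - a0"
    and "bounded_C2_on N f" and "bounded_C2_on N g"
  shows "\<exists>(\<epsilon>0::real) (c0::real) (c1::real) (c2::real) (c3::real \<Rightarrow> real) (c4::real) (K0::real).
      \<epsilon>0 > 0 \<and> c0 > 0 \<and> c1 > 0 \<and> c2 > 0 \<and> (\<forall>K1>0. c3 K1 > 0) \<and> c4 > 0 \<and> K0 > 0 \<and>
      (\<forall>\<epsilon>. 0 < \<epsilon> \<and> \<epsilon> < \<epsilon>0 \<longrightarrow>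
        (\<forall>J x y. slow_fast_solution D f g \<epsilon> J x y \<and> (x 0, y 0) \<in> N \<and> y 0 \<in> N0 \<and>
            norm (x 0 - xs (y 0)) < c0 \<longrightarrow>
          (\<forall>t\<ge>0. t \<in> J \<and> (\<forall>s\<in>{0..t}. (x s, y s) \<in> N \<and> y s \<in> N0) \<longrightarrow>
             norm (x t - xs (y t))
               \<le> c1 * \<epsilon> + c2 * norm (x 0 - xs (y 0)) * exp (- K0 * t / \<epsilon>)) \<and>
          (\<forall>J0 y0 K1. ode_solution N0 (reduced_field g xs) J0 y0 \<and> y0 0 = y 0 \<and>
              K1 > 0 \<and> K1-lipschitz_on N0 (reduced_field g xs) \<longrightarrow>
            (\<forall>t\<ge>0. t \<in> J \<and> t \<in> J0 \<and> (\<forall>s\<in>{0..t}. (x s, y s) \<in> N \<and> y s \<in> N0) \<longrightarrow>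
               norm (y t - y0 t)
                 \<le> c3 K1 * \<epsilon> * exp (K1 * t)
                   + c4 * norm (x 0 - xs (y 0)) * exp (- K0 * t / \<epsilon>)))))"
proof -
  obtain k where r: "r = Suc (Suc k)" using \<open>r \<ge> 2\<close> by (metis add_2_eq_Suc le_Suc_ex)
  obtain Bf where Bf: "\<And>p. p \<in> N \<Longrightarrow> norm (f p) \<le> Bf"
      "\<And>p u. p \<in> N \<Longrightarrow> norm (frechet_derivative f (at p) u) \<le> Bf * norm u"
      "\<And>p u v. p \<in> N \<Longrightarrow> norm (second_derivative f p u v) \<le> Bf * norm u * norm v"
    using \<open>bounded_C2_on N f\<close> unfolding bounded_C2_on_def by blast
  obtain Bg where Bg: "\<And>p. p \<in> N \<Longrightarrow> norm (g p) \<le> Bg"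
      "\<And>p u. p \<in> N \<Longrightarrow> norm (frechet_derivative g (at p) u) \<le> Bg * norm u"
    using \<open>bounded_C2_on N g\<close> unfolding bounded_C2_on_def by blast
  define B where "B = max 1 (max Bf Bg)"
  have B: "B \<ge> 1" "Bf \<le> B" "Bg \<le> B" by (auto simp: B_def)
  obtain \<delta> where \<delta>: "\<delta> > 0" and segment: "\<And>x y z. (x, y) \<in> N \<Longrightarrow> y \<in> N0 \<Longrightarrow>
      norm (x - xs y) < \<delta> \<Longrightarrow> z \<in> closed_segment (xs y) x \<Longrightarrow> (z, y) \<in> N"
    using near_graph unfolding segments_near_graph_def by blast
  have "B \<ge> 0" using B by simp
  from uniform_lyapunov[OF \<open>a0 > 0\<close> this, where 'n = 'n]
  obtain C where C: "C \<ge> 1" and lyap: "\<And>A :: real^'n^'n. (\<And>u. norm (A *v u) \<le> B * norm u) \<Longrightarrow>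
      (\<And>a. eigenvalue_of A a \<Longrightarrow> Re a \<le> - a0) \<Longrightarrow> \<exists>Q. lyapunov_for a0 C ((*v) A) Q"
    by blast
  have f_diff: "f differentiable (at p)"
    and Df_diff: "(\<lambda>q. frechet_derivative f (at q) u) differentiable (at p)"
    and g_diff: "g differentiable (at p)" if "p \<in> N" for p u
    using that \<open>N \<subseteq> D\<close> Ck_on_differentiable[OF \<open>Ck_on r D f\<close>[unfolded r]]
      Ck_on_differentiable[OF \<open>Ck_on r D g\<close>[unfolded r]] by blast+
  have Df_bound: "norm (frechet_derivative f (at p) u) \<le> B * norm u" if "p \<in> N" for p u
    using Bf(2)[OF that, of u] mult_right_mono[OF B(2), of "norm u"] by simp
  (* the Lyapunov forms come from uniform_lyapunov applied to the fast Jacobians *)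
  interpret attracting_slow_manifold N N0 f g xs B C \<delta> a0
  proof
    show "open N" "open N0" "\<delta> > 0" "B \<ge> 1" "C \<ge> 1" "a0 > 0" by fact+
    show "xs differentiable (at y)" if "y \<in> N0" for y
      using Ck_on_differentiable(1)[OF \<open>Ck_on r N0 xs\<close>[unfolded r] that] .
    show "f (xs y, y) = 0" if "y \<in> N0" "(xs y, y) \<in> N" for y
      using zero_set[OF that(2)] that(1) by simp
    show "norm (g p) \<le> B" if "p \<in> N" for p using Bg(1)[OF that] B(3) by simp
    show "norm (frechet_derivative g (at p) u) \<le> B * norm u" if "p \<in> N" for p u
      using Bg(2)[OF that, of u] mult_right_mono[OF B(3), of "norm u"] by simp
    show "norm (second_derivative f p u v) \<le> B * norm u * norm v" if "p \<in> N" for p u v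
      using Bf(3)[OF that, of u v] mult_right_mono[OF B(2), of "norm u * norm v"]
      by (simp add: mult.assoc)
    show "\<exists>Q. lyapunov_for a0 C (\<lambda>u. frechet_derivative f (at (xs y, y)) (u, 0)) Q"
      if y: "y \<in> N0" "(xs y, y) \<in> N" for y
    proof -
      let ?A = "\<lambda>u. frechet_derivative f (at (xs y, y)) (u, 0)"
      have f': "(f has_derivative frechet_derivative f (at (xs y, y))) (at (xs y, y))"
        using f_diff[OF y(2)] by (simp add: frechet_derivative_works)
      have A: "((\<lambda>x. f (x, y)) has_derivative ?A) (at (xs y))"
        using has_derivative_compose[OF has_derivative_Pair[OF has_derivative_ident has_derivative_const] f'] .
      have "(*v) (fast_jacobian f xs y) = ?A"
        unfolding fast_jacobian_def frechet_derivative_at[OF A, symmetric]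
        by (rule matrix_vector_mul(2)[OF has_derivative_linear[OF A]])
      moreover have "\<exists>Q. lyapunov_for a0 C ((*v) (fast_jacobian f xs y)) Q"
      proof (rule lyap)
        show "norm (fast_jacobian f xs y *v u) \<le> B * norm u" for u
          using calculation Df_bound[OF y(2), of "(u, 0)"] by simp
      qed (rule stable[OF y(1)])
      ultimately show ?thesis by simp
    qed
  qed (use f_diff Df_diff g_diff Df_bound segment in blast)+
  note pos = constants_pos a0_pos
  (* K0: one halving per window; c0 and epsilon0 leave room for the lost factor C *)
  define K0 c0 c1 c2 where "K0 = ln 2 / window" and "c0 = \<rho> / (4 * C)" and "c1 = 3 * C * \<kappa>" and "c2 = 2 * C"
  define \<epsilon>0 where "\<epsilon>0 = min (\<rho> / (6 * C * \<kappa>)) (a0 / (16 * C * window * drift_rate))"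
  define c3 where "c3 K1 = 1 + B * c1 / K1 + B * c2 * c0 / K0" for K1
  have cpos: "K0 > 0" "c0 > 0" "c1 > 0" "c2 > 0" "\<epsilon>0 > 0"
    using pos by (auto simp: K0_def c0_def c1_def c2_def \<epsilon>0_def)
  have c3: "c3 K1 > 0" if "K1 > 0" for K1
    unfolding c3_def using that pos cpos by (intro add_pos_nonneg) auto
  have main: "\<forall>\<epsilon>. 0 < \<epsilon> \<and> \<epsilon> < \<epsilon>0 \<longrightarrow>
        (\<forall>J x y. slow_fast_solution D f g \<epsilon> J x y \<and> (x 0, y 0) \<in> N \<and> y 0 \<in> N0 \<and>
            norm (x 0 - xs (y 0)) < c0 \<longrightarrow>
          (\<forall>t\<ge>0. t \<in> J \<and> (\<forall>s\<in>{0..t}. (x s, y s) \<in> N \<and> y s \<in> N0) \<longrightarrow>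
             norm (x t - xs (y t))
               \<le> c1 * \<epsilon> + c2 * norm (x 0 - xs (y 0)) * exp (- K0 * t / \<epsilon>)) \<and>
          (\<forall>J0 y0 K1. ode_solution N0 (reduced_field g xs) J0 y0 \<and> y0 0 = y 0 \<and>
              K1 > 0 \<and> K1-lipschitz_on N0 (reduced_field g xs) \<longrightarrow>
            (\<forall>t\<ge>0. t \<in> J \<and> t \<in> J0 \<and> (\<forall>s\<in>{0..t}. (x s, y s) \<in> N \<and> y s \<in> N0) \<longrightarrow>
               norm (y t - y0 t)
                 \<le> c3 K1 * \<epsilon> * exp (K1 * t)
                   + 1 * norm (x 0 - xs (y 0)) * exp (- K0 * t / \<epsilon>))))"
  proof (intro allI impI, elim conjE)
    fix \<epsilon> J x y
    assume \<epsilon>: "0 < \<epsilon>" "\<epsilon> < \<epsilon>0" and sol: "slow_fast_solution D f g \<epsilon> J x y"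
      and start: "norm (x 0 - xs (y 0)) < c0"
    define d where "d = norm (x 0 - xs (y 0))"
    have d: "d \<ge> 0" "d \<le> c0" using start by (auto simp: d_def)
    have small: "\<epsilon> * window * drift_rate \<le> a0 / (16 * C)" "3 * C * \<kappa> * \<epsilon> < \<rho> / 2"
      using \<epsilon>(2) pos unfolding \<epsilon>0_def by (auto simp: field_simps)
    have traj: "trajectory \<epsilon> 0 t x y"
      if t: "t \<in> J" and inN: "\<And>s. s \<in> {0..t} \<Longrightarrow> (x s, y s) \<in> N \<and> y s \<in> N0" for t
      unfolding trajectory_def
    proof (intro ballI conjI)
      fix s assume s: "s \<in> {0..t}"
      have sub: "{0..t} \<subseteq> J"
        using sol t by (auto simp: slow_fast_solution_def intro: mem_is_interval_1_I)
      then have "s \<in> J" using s by blast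
      with sol obtain x' where x': "(x has_vector_derivative x') (at s within J)" "\<epsilon> *\<^sub>R x' = f (x s, y s)"
          and y': "(y has_vector_derivative g (x s, y s)) (at s within J)"
        unfolding slow_fast_solution_def by blast
      have "x' = (1 / \<epsilon>) *\<^sub>R f (x s, y s)" using \<epsilon>(1) by (simp flip: x'(2))
      then show "(x has_vector_derivative (1 / \<epsilon>) *\<^sub>R f (x s, y s)) (at s within {0..t})"
        using has_vector_derivative_within_subset[OF x'(1) sub] by simp
      show "(y has_vector_derivative g (x s, y s)) (at s within {0..t})"
        by (rule has_vector_derivative_within_subset[OF y' sub])
    qed (use inN in auto)
    have part1: "norm (x t - xs (y t)) \<le> c1 * \<epsilon> + c2 * d * exp (- K0 * t / \<epsilon>)"
      and near: "norm (x t - xs (y t)) < \<delta>"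
      if "trajectory \<epsilon> 0 t x y" "t \<ge> 0" for t
      using slow_manifold_attraction[OF that \<epsilon>(1) small] start
      by (auto simp: c0_def c1_def c2_def K0_def d_def)
    have part2: "norm (y t - y0 t) \<le> c3 K1 * \<epsilon> * exp (K1 * t) + 1 * d * exp (- K0 * t / \<epsilon>)"
      if red: "ode_solution N0 (reduced_field g xs) J0 y0" "y0 0 = y 0"
        and K1: "K1 > 0" "K1-lipschitz_on N0 (reduced_field g xs)"
        and t: "t \<ge> 0" "t \<in> J0" and traj: "trajectory \<epsilon> 0 t x y" for J0 y0 K1 t
    proof -
      have sub: "{0..t} \<subseteq> J0"
        using red(1) t by (auto simp: ode_solution_def intro: mem_is_interval_1_I)
      have restr: "trajectory \<epsilon> 0 s x y" if "s \<in> {0..t}" for s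
        using that by (intro trajectory_mono[OF traj]) auto
      have "norm (y t - y0 t) \<le> (1 + B * c1 / K1 + B * c2 * d / K0) * \<epsilon> * exp (K1 * t)"
      proof (rule reduced_dynamics_error[where ?y0.0 = y0, OF traj t(1) \<epsilon>(1) _ _ cpos(1) d(1) _ _ _ red(2) K1])
        fix s assume s: "s \<in> {0..t}"
        show "norm (x s - xs (y s)) \<le> c1 * \<epsilon> + c2 * d * exp (- K0 * s / \<epsilon>)"
          and "norm (x s - xs (y s)) < \<delta>"
          using part1[OF restr[OF s]] near[OF restr[OF s]] s by auto
        have "s \<in> J0" using s sub by blast
        then show "y0 s \<in> N0 \<and> (y0 has_vector_derivative reduced_field g xs (y0 s)) (at s within {0..t})"
          using red(1) sub unfolding ode_solution_def
          by (blast intro: has_vector_derivative_within_subset)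
      qed (use cpos in auto)
      also have "\<dots> \<le> c3 K1 * \<epsilon> * exp (K1 * t)"
        unfolding c3_def using d(2) pos cpos \<epsilon>
        by (intro mult_right_mono add_left_mono divide_right_mono mult_left_mono) auto
      also have "\<dots> \<le> c3 K1 * \<epsilon> * exp (K1 * t) + 1 * d * exp (- K0 * t / \<epsilon>)"
        using d(1) by simp
      finally show ?thesis .
    qed
    show "(\<forall>t\<ge>0. t \<in> J \<and> (\<forall>s\<in>{0..t}. (x s, y s) \<in> N \<and> y s \<in> N0) \<longrightarrow>
             norm (x t - xs (y t))
               \<le> c1 * \<epsilon> + c2 * norm (x 0 - xs (y 0)) * exp (- K0 * t / \<epsilon>)) \<and>
          (\<forall>J0 y0 K1. ode_solution N0 (reduced_field g xs) J0 y0 \<and> y0 0 = y 0 \<and>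
              K1 > 0 \<and> K1-lipschitz_on N0 (reduced_field g xs) \<longrightarrow>
            (\<forall>t\<ge>0. t \<in> J \<and> t \<in> J0 \<and> (\<forall>s\<in>{0..t}. (x s, y s) \<in> N \<and> y s \<in> N0) \<longrightarrow>
               norm (y t - y0 t)
                 \<le> c3 K1 * \<epsilon> * exp (K1 * t)
                   + 1 * norm (x 0 - xs (y 0)) * exp (- K0 * t / \<epsilon>)))"
    proof (intro conjI allI impI; elim conjE)
      fix t assume t: "t \<ge> 0" "t \<in> J" "\<forall>s\<in>{0..t}. (x s, y s) \<in> N \<and> y s \<in> N0"
      have tr: "trajectory \<epsilon> 0 t x y" by (rule traj[OF t(2)]) (use t(3) in blast)
      show "norm (x t - xs (y t)) \<le> c1 * \<epsilon> + c2 * norm (x 0 - xs (y 0)) * exp (- K0 * t / \<epsilon>)"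
        using part1[OF tr t(1)] by (simp only: d_def)
      fix J0 y0 K1
      assume "ode_solution N0 (reduced_field g xs) J0 y0" "y0 0 = y 0"
        "K1 > 0" "K1-lipschitz_on N0 (reduced_field g xs)" "t \<in> J0"
      then show "norm (y t - y0 t) \<le> c3 K1 * \<epsilon> * exp (K1 * t)
                   + 1 * norm (x 0 - xs (y 0)) * exp (- K0 * t / \<epsilon>)"
        using part2[of J0 y0 K1 t] t(1) tr by (simp only: d_def)
    qed
  qed
  have "\<forall>K1>0. c3 K1 > 0" using c3 by blast
  then show ?thesis
    by (intro exI[of _ \<epsilon>0] exI[of _ c0] exI[of _ c1] exI[of _ c2] exI[of _ c3] exI[of _ 1] exI[of _ K0]
        conjI main cpos zero_less_one)
qed

end
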